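(* Let $q$ be a prime power. For $a\in\mathbb{Z}+\frac12$ and $t>0$, let $Z^{\mathrm{odd}}_{a,t}$ be the process defined in the context started from $Z^{\mathrm{odd}}_{a,0}=a$, and let $D^{\mathrm{odd}}_{a,t}$ be the number of downward jumps made by this process until time $t$. Then for any fixed $t>0$, as $a$ tends to $-\infty$, the pair $(D^{\mathrm{odd}}_{a,t},Z^{\mathrm{odd}}_{a,t})$ converges in total variation distance to some random variable $(D^{\mathrm{odd}}_{-\infty,t},Z^{\mathrm{odd}}_{-\infty,t})$.
   Context: $(Z^{\mathrm{odd}}_t)_{t\ge 0}$ is the continuous time Markov chain on $\mathbb{Z}+\frac12=\{a+\frac12: a\in\mathbb{Z}\}$ with transition rates $Q(a,a+1)=q^{-a}$, $Q(a,a-1)=q^{a}$, $Q(a,a)=-q^a-q^{-a}$, and $Q(a,b)=0$ otherwise (it has no explosions). A downward jump is a jump from some $b$ to $b-1$; a downward jump at time exactly $t$ is counted. *)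

theory Defs
  imports "HOL-Probability.Probability" "HOL-Number_Theory.Prime_Powers"
begin

definition half_ints :: "real set" where
  "half_ints = {of_int k + 1/2 | k. True}"

text \<open>
  A continuous time Markov chain with countable state space \<open>S\<close>, rate matrix \<open>Q\<close>
  (without absorbing states, i.e. \<open>Q x x < 0\<close>) and initial state \<open>x0\<close>, given by its jump chain
  \<open>Y\<close> and its holding times \<open>H\<close>:
  \<open>Y\<close> is a discrete time Markov chain started from \<open>x0\<close> that moves from \<open>x\<close> to \<open>y \<noteq> x\<close> with
  probability \<open>Q x y / (- Q x x)\<close>, and conditionally on \<open>Y\<close> the holding times are
  independent, \<open>H n\<close> being exponential with parameter \<open>- Q (Y n) (Y n)\<close>.
  The joint law of \<open>Y 0, \<dots>, Y n, H 0, \<dots>, H (n - 1)\<close> is specified through the events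
  \<open>Y i = y i\<close> and \<open>H i > s i\<close>.
  The divergence of the jump times says that the process has no explosions; thus every
  path is right-continuous with finitely many jumps in each bounded time interval.
\<close>

definition jump_prob :: "('s \<Rightarrow> 's \<Rightarrow> real) \<Rightarrow> 's \<Rightarrow> 's \<Rightarrow> real" where
  "jump_prob Q x y = (if x = y then 0 else Q x y / (- Q x x))"

definition jump_time :: "(nat \<Rightarrow> 'w \<Rightarrow> real) \<Rightarrow> nat \<Rightarrow> 'w \<Rightarrow> real" where
  "jump_time H n \<omega> = (\<Sum>i<n. H i \<omega>)"

definition jump_hold_law ::
  "'w measure \<Rightarrow> 's set \<Rightarrow> ('s \<Rightarrow> 's \<Rightarrow> real) \<Rightarrow> 's \<Rightarrow> (nat \<Rightarrow> 'w \<Rightarrow> 's) \<Rightarrow> (nat \<Rightarrow> 'w \<Rightarrow> real) \<Rightarrow> bool"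
where
  "jump_hold_law M S Q x0 Y H \<longleftrightarrow>
    (\<forall>n y s. (\<forall>i\<le>n. y i \<in> S) \<longrightarrow> (\<forall>i<n. 0 \<le> s i) \<longrightarrow>
      measure M {\<omega> \<in> space M. (\<forall>i\<le>n. Y i \<omega> = y i) \<and> (\<forall>i<n. s i < H i \<omega>)} =
        (if y 0 = x0 then 1 else 0) *
        (\<Prod>i<n. jump_prob Q (y i) (y (Suc i)) * exp (- (- Q (y i) (y i)) * s i)))"

definition ctmc ::
  "'w measure \<Rightarrow> 's set \<Rightarrow> ('s \<Rightarrow> 's \<Rightarrow> real) \<Rightarrow> 's \<Rightarrow> (real \<Rightarrow> 'w \<Rightarrow> 's) \<Rightarrow> bool"
where
  "ctmc M S Q x0 X \<longleftrightarrow> prob_space M \<and>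
    (\<exists>Y H. (\<forall>n. Y n \<in> measurable M (count_space S)) \<and>
           (\<forall>n. H n \<in> borel_measurable M) \<and>
           jump_hold_law M S Q x0 Y H \<and>
           (\<forall>\<omega>\<in>space M.
              (\<forall>n. 0 < H n \<omega>) \<and>
              filterlim (\<lambda>n. jump_time H n \<omega>) at_top sequentially \<and>
              (\<forall>n. \<forall>t. jump_time H n \<omega> \<le> t \<and> t < jump_time H (Suc n) \<omega> \<longrightarrow> X t \<omega> = Y n \<omega>)))"

definition Q_odd :: "real \<Rightarrow> real \<Rightarrow> real \<Rightarrow> real" where
  "Q_odd q a b =
    (if b = a + 1 then q powr (- a)
     else if b = a - 1 then q powr a
     else if b = a then - (q powr a) - q powr (- a)
     else 0)"

text \<open>
  The left limit at \<open>s\<close> is taken in the discrete topology of the state space. The set below is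
  finite for the paths of a \<open>ctmc\<close>.
\<close>

definition down_jumps :: "(real \<Rightarrow> 'w \<Rightarrow> real) \<Rightarrow> real \<Rightarrow> 'w \<Rightarrow> nat" where
  "down_jumps X t \<omega> =
    card {s. 0 < s \<and> s \<le> t \<and> (\<exists>b. (\<forall>\<^sub>F u in at_left s. X u \<omega> = b) \<and> X s \<omega> = b - 1)}"

definition tv_dist :: "'b measure \<Rightarrow> 'b measure \<Rightarrow> real" where
  "tv_dist M N = (SUP A\<in>sets M. \<bar>measure M A - measure N A\<bar>)"

end

theory Submission
  imports Defs
begin

text \<open>
  Write \<open>r\<^sub>b = q\<^sup>b + q\<^sup>-\<^sup>b\<close> for the rate at which the chain leaves \<open>b\<close>. Far to the left the chain
  rises quickly and almost without downward jumps: it leaves a level \<open>b < 0\<close> downwards with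
  probability at most \<open>q\<^sup>2\<^sup>b\<close>, and its mean holding time there is at most \<open>q\<^sup>b\<close>. Both bounds are summable
  over the levels below \<open>b\<close>, so a chain started at \<open>a < b\<close> reaches \<open>b\<close> without a downward jump, after
  a time \<open>T\<close> of order \<open>q\<^sup>b\<close>, up to an event of small probability. Its observation at time \<open>t\<close> is then
  that of a chain started at \<open>b\<close> at time \<open>t - T\<close>, and the question is whether the small shift
  \<open>T\<close> changes the law much.

  The holding time at \<open>b\<close> alone does not absorb the shift, because \<open>r\<^sub>b T\<close> is of order 1. The
  shift is absorbed at a level \<open>c\<close> that stays fixed while \<open>b\<close> tends to \<open>-\<infinity>\<close>: the chain has to wait at
  \<open>c\<close> for an exponential time of rate \<open>r\<^sub>c\<close>, whose law moves by at most \<open>r\<^sub>c T\<close> in total variation when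
  it is shifted by \<open>T\<close>, and it passes \<open>c\<close> well before time \<open>t\<close> except with a probability that is small if
  \<open>c\<close> is far to the left. Choosing first \<open>c\<close> and then \<open>b\<close> shows that the laws of the
  observation form a Cauchy family in total variation (\<open>obs_prob_Cauchy\<close>). Total variation is
  complete (\<open>uniformly_Cauchy_prob_converges\<close>), which gives the limit.

  All estimates come from one renewal equation, \<open>obs_prob_first_step\<close>, for the probability that the
  observation lies in a set \<open>A\<close>, obtained by conditioning on the first jump; uniformity in \<open>A\<close> is what
  makes them total variation estimates. Passage through many levels is never treated directly:
  \<open>propagate_down_levels\<close> carries a bound from one level to all lower ones by induction, and it is
  used twice, once for the shift in time (\<open>obs_prob_time_regularity\<close>) and once for the change of
  starting point (\<open>obs_prob_level_comparison\<close>).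

  The processes with different starting points live on unrelated probability spaces. They are
  compared through their laws on a common space of trajectories, that is, of sequences of
  states and holding times; the Markov property at the first jump, \<open>emeasure_first_jump\<close>, is a
  statement about these laws.
\<close>

section \<open>The exponential distribution\<close>

definition exp_law :: "real \<Rightarrow> real measure" where
  "exp_law r = density lborel (exponential_density r)"

lemma sets_exp_law [simp, measurable_cong]: "sets (exp_law r) = sets borel"
  and space_exp_law [simp]: "space (exp_law r) = UNIV"
  by (simp_all add: exp_law_def)

lemma prob_space_exp_law: "0 < r \<Longrightarrow> prob_space (exp_law r)"
  unfolding exp_law_def by (rule prob_space_exponential_density)

lemma measure_exp_law_greaterThan:
  assumes "0 < r" shows "measure (exp_law r) {s<..} = (if 0 \<le> s then exp (- r * s) else 1)"
proof -
  interpret prob_space "exp_law r" using assms by (rule prob_space_exp_law)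
  have "emeasure (exp_law r) {..s} = erlang_CDF 0 r s"
    unfolding exp_law_def using assms by (rule emeasure_erlang_density)
  moreover have "0 \<le> erlang_CDF 0 r s" using assms by simp
  ultimately have "prob {..s} = erlang_CDF 0 r s" by (simp add: measure_def)
  moreover have "prob {s<..} = 1 - prob {..s}"
    by (subst prob_compl[symmetric]) (auto simp: Compl_eq_Diff_UNIV[symmetric])
  ultimately show ?thesis by (simp add: erlang_CDF_0)
qed

lemma AE_exp_law_nonneg: "AE h in exp_law r. 0 \<le> h"
  unfolding exp_law_def by (subst AE_density) (auto simp: exponential_density_def)

lemma exp_law_ith_moment_one:
  assumes "0 < r"
  shows "integrable (exp_law r) (\<lambda>h. h)" "(\<integral>h. h \<partial>exp_law r) = 1 / r"
proof -
  interpret prob_space "exp_law r" using assms by (rule prob_space_exp_law)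
  have "distributed (exp_law r) lborel (\<lambda>x. x) (exponential_density r)"
    unfolding distributed_def exp_law_def by (auto intro!: distr_id2)
  from erlang_ith_moment_integrable[OF assms this, of 1] exponential_distributed_expectation[OF assms this]
  show "integrable (exp_law r) (\<lambda>h. h)" "(\<integral>h. h \<partial>exp_law r) = 1 / r" by simp_all
qed

text \<open>
  The density of rate \<open>r\<close>, tilted by \<open>exp (l * h)\<close>, is a multiple of the density of rate \<open>r - l\<close>.
\<close>

lemma exp_law_exp_moment:
  assumes "0 < r" "l < r"
  shows "integrable (exp_law r) (\<lambda>h. exp (l * h))" "(\<integral>h. exp (l * h) \<partial>exp_law r) = r / (r - l)"
proof -
  have eq: "exponential_density r h * exp (l * h) = r / (r - l) * exponential_density (r - l) h" for h
    using assms by (auto simp: exponential_density_def field_simps exp_add[symmetric])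
  interpret prob_space "exp_law (r - l)" using assms by (intro prob_space_exp_law) simp
  have "1 = (\<integral>h. (1 :: real) \<partial>exp_law (r - l))" using prob_space[simplified] by simp
  also have "\<dots> = (\<integral>h. exponential_density (r - l) h *\<^sub>R 1 \<partial>lborel)"
    unfolding exp_law_def using assms by (intro integral_density) (auto simp: exponential_density_nonneg)
  finally have "(\<integral>h. exponential_density (r - l) h \<partial>lborel) = 1" by simp
  moreover from this have "integrable lborel (exponential_density (r - l))"
    by (metis not_integrable_integral_eq zero_neq_one)
  ultimately have "has_bochner_integral lborel (exponential_density (r - l)) 1"
    by (simp add: has_bochner_integral_iff)
  then have "has_bochner_integral lborel (\<lambda>h. exponential_density r h * exp (l * h)) (r / (r - l) * 1)"
    unfolding eq by (intro has_bochner_integral_mult_right)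
  then show "integrable (exp_law r) (\<lambda>h. exp (l * h))" "(\<integral>h. exp (l * h) \<partial>exp_law r) = r / (r - l)"
    using assms unfolding exp_law_def
    by (simp_all add: has_bochner_integral_iff integrable_density integral_density exponential_density_nonneg)
qed

lemma integrable_exp_law_bounded:
  fixes g :: "real \<Rightarrow> real"
  assumes "0 < r" and [measurable]: "g \<in> borel_measurable borel" and "\<And>h. \<bar>g h\<bar> \<le> B"
  shows "integrable (exp_law r) g"
proof -
  interpret prob_space "exp_law r" using assms(1) by (rule prob_space_exp_law)
  show ?thesis using assms(3) by (intro integrable_const_bound[of _ B]) auto
qed

text \<open>
  This is the smoothing effect of a holding time. By lack of memory the law shifted by \<open>s\<close>
  makes up the fraction \<open>exp (- r * s)\<close> of the original law, so the two differ in total variation by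
  at most \<open>1 - exp (- r * s)\<close>.
\<close>

lemma exp_law_shift_le:
  fixes g :: "real \<Rightarrow> real"
  assumes r: "0 < r" and s: "0 \<le> s" and [measurable]: "g \<in> borel_measurable borel"
    and g: "\<And>h. 0 \<le> g h" "\<And>h. g h \<le> 1"
  shows "\<bar>(\<integral>h. g h \<partial>exp_law r) - (\<integral>h. g (s + h) \<partial>exp_law r)\<bar> \<le> r * s"
proof -
  interpret prob_space "exp_law r" using r by (rule prob_space_exp_law)
  let ?f = "exponential_density r"
  have nn: "0 \<le> ?f h" for h using r by (rule exponential_density_nonneg)
  have g1: "\<bar>g h\<bar> \<le> 1" for h using g[of h] by simp
  have int: "integrable lborel (\<lambda>h. ?f h * k h)" "(\<integral>h. k h \<partial>exp_law r) = (\<integral>h. ?f h * k h \<partial>lborel)"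
    if [measurable]: "k \<in> borel_measurable borel" and k: "\<And>h. \<bar>k h\<bar> \<le> 1" for k :: "real \<Rightarrow> real"
    using integrable_exp_law_bounded[OF r that] nn
    unfolding exp_law_def by (simp_all add: integrable_density integral_density)
  have shift: "integrable lborel (\<lambda>h. ?f (s + h) * k (s + h))"
      "(\<integral>h. ?f (s + h) * k (s + h) \<partial>lborel) = (\<integral>h. k h \<partial>exp_law r)"
    if [measurable]: "k \<in> borel_measurable borel" and k: "\<And>h. \<bar>k h\<bar> \<le> 1" for k :: "real \<Rightarrow> real"
    using lborel_integrable_real_affine[OF int(1)[OF that], of 1 s]
      lborel_integral_real_affine[of 1 "\<lambda>h. ?f h * k h" s] int(2)[OF that] by simp_all
  have low: "exp (- r * s) * ?f h \<le> ?f (s + h)" for h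
    using r s by (auto simp: exponential_density_def exp_add[symmetric] algebra_simps)
  \<comment> \<open>The integral of \<open>k\<close> over the part of the law that lies below \<open>s\<close>, written after the translation by \<open>s\<close>.\<close>
  let ?R = "\<lambda>k. (\<integral>h. (?f (s + h) - exp (- r * s) * ?f h) * k (s + h) \<partial>lborel)"
  have intR: "integrable lborel (\<lambda>h. (?f (s + h) - exp (- r * s) * ?f h) * k (s + h))"
    and R: "?R k = (\<integral>h. k h \<partial>exp_law r) - exp (- r * s) * (\<integral>h. k (s + h) \<partial>exp_law r)"
    if [measurable]: "k \<in> borel_measurable borel" and k: "\<And>h. \<bar>k h\<bar> \<le> 1" for k :: "real \<Rightarrow> real"
  proof -
    have 1: "integrable lborel (\<lambda>h. exp (- r * s) * (?f h * k (s + h)))"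
      using int(1)[of "\<lambda>h. k (s + h)"] k by simp
    have 2: "(?f (s + h) - exp (- r * s) * ?f h) * k (s + h)
        = ?f (s + h) * k (s + h) - exp (- r * s) * (?f h * k (s + h))" for h
      by (simp add: algebra_simps)
    show "integrable lborel (\<lambda>h. (?f (s + h) - exp (- r * s) * ?f h) * k (s + h))"
      unfolding 2 using shift(1)[of k] k 1 by (intro Bochner_Integration.integrable_diff) auto
    show "?R k = (\<integral>h. k h \<partial>exp_law r) - exp (- r * s) * (\<integral>h. k (s + h) \<partial>exp_law r)"
      unfolding 2 using shift[of k] k 1 int(2)[of "\<lambda>h. k (s + h)"]
      by (subst Bochner_Integration.integral_diff) auto
  qed
  have "0 \<le> ?R g" using low g by (intro integral_nonneg_AE AE_I2 mult_nonneg_nonneg) (auto simp: algebra_simps)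
  moreover have "?R g \<le> ?R (\<lambda>_. 1)"
    using low g g1 by (intro integral_mono intR mult_left_mono) (auto simp: algebra_simps)
  moreover have "?R (\<lambda>_. 1) = 1 - exp (- r * s)"
    by (subst R) (auto simp: prob_space[simplified])
  moreover have "1 - exp (- r * s) \<le> r * s" using exp_ge_add_one_self[of "- r * s"] by simp
  moreover have "0 \<le> (\<integral>h. g (s + h) \<partial>exp_law r)" using g by (intro integral_nonneg_AE) auto
  moreover have "(\<integral>h. g (s + h) \<partial>exp_law r) \<le> 1"
    using g by (intro integral_le_const integrable_exp_law_bounded[OF r, where B=1] g1) auto
  moreover have "0 \<le> 1 - exp (- r * s)" using r s by simp
  ultimately have "0 \<le> ?R g" "?R g \<le> r * s"
    "0 \<le> (1 - exp (- r * s)) * (\<integral>h. g (s + h) \<partial>exp_law r)"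
    "(1 - exp (- r * s)) * (\<integral>h. g (s + h) \<partial>exp_law r) \<le> r * s"
    using mult_left_le[of "\<integral>h. g (s + h) \<partial>exp_law r" "1 - exp (- r * s)"]
    by (auto intro: mult_nonneg_nonneg)
  moreover have "?R g = (\<integral>h. g h \<partial>exp_law r) - exp (- r * s) * (\<integral>h. g (s + h) \<partial>exp_law r)"
    by (rule R) (use g1 in auto)
  ultimately show ?thesis by (simp add: algebra_simps abs_le_iff)
qed

section \<open>The space of trajectories\<close>

text \<open>
  A trajectory lists the successive states and holding times. Holding times are
  positive by definition: tail probabilities at nonnegative thresholds then determine their law.
\<close>

definition traj :: "'s set \<Rightarrow> (nat \<Rightarrow> 's \<times> real) set" where
  "traj S = {\<xi>. \<forall>n. fst (\<xi> n) \<in> S \<and> 0 < snd (\<xi> n)}"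

text \<open>
  A cylinder prescribes one more state than it restricts holding times, as in
  \<open>jump_hold_law\<close>: the probability of the \<open>n\<close>-th jump involves the state after it.
\<close>

definition cylinder :: "'s set \<Rightarrow> nat \<Rightarrow> (nat \<Rightarrow> 's) \<Rightarrow> (nat \<Rightarrow> real) \<Rightarrow> (nat \<Rightarrow> 's \<times> real) set" where
  "cylinder S n y s = {\<xi> \<in> traj S. (\<forall>i\<le>n. fst (\<xi> i) = y i) \<and> (\<forall>i<n. s i < snd (\<xi> i))}"

text \<open>
  The empty set is added to make the family closed under intersection.
\<close>

definition cylinders :: "'s set \<Rightarrow> (nat \<Rightarrow> 's \<times> real) set set" where
  "cylinders S = insert {} {cylinder S n y s | n y s. (\<forall>i\<le>n. y i \<in> S) \<and> (\<forall>i<n. 0 \<le> s i)}"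

definition traj_space :: "'s set \<Rightarrow> (nat \<Rightarrow> 's \<times> real) measure" where
  "traj_space S = sigma (traj S) (cylinders S)"

lemma cylinders_Pow: "cylinders S \<subseteq> Pow (traj S)"
  by (auto simp: cylinders_def cylinder_def)

lemma space_traj_space [simp]: "space (traj_space S) = traj S"
  and sets_traj_space: "sets (traj_space S) = sigma_sets (traj S) (cylinders S)"
  unfolding traj_space_def using cylinders_Pow[of S] by (simp_all add: space_measure_of_conv)

lemma cylinder_in_sets:
  "(\<And>i. i \<le> n \<Longrightarrow> y i \<in> S) \<Longrightarrow> (\<And>i. i < n \<Longrightarrow> 0 \<le> s i) \<Longrightarrow> cylinder S n y s \<in> sets (traj_space S)"
  unfolding sets_traj_space by (rule sigma_sets.Basic) (unfold cylinders_def, blast)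

text \<open>
  The longer cylinder decides the states, and thresholds are combined by maximum; beyond its
  own length the shorter cylinder imposes nothing.
\<close>

lemma cylinder_Int_le:
  assumes "n \<le> m"
  shows "cylinder S n y s \<inter> cylinder S m z r =
    (if \<forall>i\<le>n. y i = z i then cylinder S m z (\<lambda>i. if i < n then max (s i) (r i) else r i) else {})"
  using assms by (auto simp: cylinder_def split: if_splits)

lemma Int_stable_cylinders: "Int_stable (cylinders S)"
proof (rule Int_stableI)
  have wlog: "cylinder S n y s \<inter> cylinder S m z r \<in> cylinders S"
    if "n \<le> m" "\<forall>i\<le>m. z i \<in> S" "\<forall>i<n. 0 \<le> s i" "\<forall>i<m. 0 \<le> r i" for n m y z and s r :: "nat \<Rightarrow> real"
    unfolding cylinder_Int_le[OF that(1)] using that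
    by (auto simp: cylinders_def le_max_iff_disj intro!: exI[of _ m] exI[of _ z] exI[of _ "\<lambda>i. if i < n then max (s i) (r i) else r i"])
  fix A B assume "A \<in> cylinders S" "B \<in> cylinders S"
  then consider "A = {} \<or> B = {}" | n y s m z r where "A = cylinder S n y s" "B = cylinder S m z r"
      "\<forall>i\<le>n. y i \<in> S" "\<forall>i<n. 0 \<le> s i" "\<forall>i\<le>m. z i \<in> S" "\<forall>i<m. 0 \<le> r i"
    unfolding cylinders_def by auto
  then show "A \<inter> B \<in> cylinders S"
  proof cases
    case 1 then show ?thesis by (auto simp: cylinders_def)
  next
    case 2
    then show ?thesis using wlog[of n m z s r y] wlog[of m n y r s z]
      by (cases "n \<le> m") (auto simp: Int_commute)
  qed
qed

text \<open>
  The \<open>\<sigma>\<close>-algebra generated by the cylinders is not larger than the one generated by the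
  coordinates; the next lemmas show that, for countable \<open>S\<close>, it is not smaller either.
\<close>

lemma measurable_into_traj_space:
  assumes Y [measurable]: "\<And>n. (\<lambda>\<omega>. fst (f \<omega> n)) \<in> measurable M (count_space S)"
    and H [measurable]: "\<And>n. (\<lambda>\<omega>. snd (f \<omega> n)) \<in> borel_measurable M"
    and pos: "\<And>\<omega> n. \<omega> \<in> space M \<Longrightarrow> 0 < snd (f \<omega> n)"
  shows "f \<in> measurable M (traj_space S)"
  unfolding traj_space_def
proof (rule measurable_measure_of[OF cylinders_Pow])
  show f: "f \<in> space M \<rightarrow> traj S"
    using pos measurable_space[OF Y] by (auto simp: traj_def)
  fix A assume "A \<in> cylinders S"
  then consider "A = {}" | n y s where "A = cylinder S n y s" "\<forall>i\<le>n. y i \<in> S"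
    unfolding cylinders_def by auto
  then show "f -` A \<inter> space M \<in> sets M"
  proof cases
    case 2
    have [measurable]: "{\<omega>\<in>space M. fst (f \<omega> i) = y i} \<in> sets M" if "i \<le> n" for i
    proof -
      have "{y i} \<in> sets (count_space S)" using 2 that by auto
      from measurable_sets[OF Y this] show ?thesis
        by (simp add: vimage_def Int_def conj_commute)
    qed
    have "f -` A \<inter> space M = {\<omega>\<in>space M. (\<forall>i\<in>{..n}. fst (f \<omega> i) = y i) \<and> (\<forall>i\<in>{..<n}. s i < snd (f \<omega> i))}"
      using f 2 by (auto simp: cylinder_def)
    also have "\<dots> \<in> sets M"
      by (intro sets.sets_Collect_conj sets.sets_Collect_finite_All) auto
    finally show ?thesis .
  qed auto
qed

lemma countable_cylinder_bases: "countable S \<Longrightarrow> countable (PiE {..n::nat} (\<lambda>_. S))"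
  by (intro countable_PiE) auto

text \<open>
  A cylinder fixes all states up to its length, so an event about a single coordinate is the
  union of the cylinders over all choices of the other states.
\<close>

lemma measurable_traj_state [measurable]:
  assumes "countable S"
  shows "(\<lambda>\<xi>. fst (\<xi> n)) \<in> measurable (traj_space S) (count_space S)"
  unfolding measurable_count_space_eq_countable[OF assms]
proof (intro conjI ballI)
  show "(\<lambda>\<xi>. fst (\<xi> n)) \<in> space (traj_space S) \<rightarrow> S" by (auto simp: traj_def)
  fix z assume z: "z \<in> S"
  have "(\<lambda>\<xi>. fst (\<xi> n)) -` {z} \<inter> space (traj_space S) =
      (\<Union>y\<in>{y\<in>PiE {..n} (\<lambda>_. S). y n = z}. cylinder S n y (\<lambda>_. 0))"
  proof (intro equalityI subsetI)
    fix \<xi> assume "\<xi> \<in> (\<lambda>\<xi>. fst (\<xi> n)) -` {z} \<inter> space (traj_space S)"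
    then show "\<xi> \<in> (\<Union>y\<in>{y\<in>PiE {..n} (\<lambda>_. S). y n = z}. cylinder S n y (\<lambda>_. 0))"
      by (intro UN_I[of "restrict (\<lambda>i. fst (\<xi> i)) {..n}"]) (auto simp: cylinder_def traj_def)
  qed (auto simp: cylinder_def)
  also have "\<dots> \<in> sets (traj_space S)"
  proof (rule sets.countable_UN'')
    show "countable {y \<in> PiE {..n} (\<lambda>_. S). y n = z}"
      by (rule countable_subset[OF _ countable_cylinder_bases[OF assms, of n]]) auto
    show "cylinder S n y (\<lambda>_. 0) \<in> sets (traj_space S)" if "y \<in> {y \<in> PiE {..n} (\<lambda>_. S). y n = z}" for y
      by (rule cylinder_in_sets) (use that in \<open>auto dest: PiE_mem\<close>)
  qed
  finally show "(\<lambda>\<xi>. fst (\<xi> n)) -` {z} \<inter> space (traj_space S) \<in> sets (traj_space S)" .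
qed

lemma measurable_traj_hold [measurable]:
  assumes "countable S"
  shows "(\<lambda>\<xi>. snd (\<xi> n)) \<in> borel_measurable (traj_space S)"
  unfolding borel_measurable_iff_greater
proof
  fix s :: real
  let ?s = "\<lambda>i. if i = n then max s 0 else 0"
  have "{\<xi>\<in>space (traj_space S). s < snd (\<xi> n)} = {\<xi>\<in>space (traj_space S). max s 0 < snd (\<xi> n)}"
    by (auto simp: traj_def)
  also have "\<dots> = (\<Union>y\<in>PiE {..Suc n} (\<lambda>_. S). cylinder S (Suc n) y ?s)"
  proof (intro equalityI subsetI)
    fix \<xi> assume "\<xi> \<in> {\<xi>\<in>space (traj_space S). max s 0 < snd (\<xi> n)}"
    then show "\<xi> \<in> (\<Union>y\<in>PiE {..Suc n} (\<lambda>_. S). cylinder S (Suc n) y ?s)"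
      by (intro UN_I[of "restrict (\<lambda>i. fst (\<xi> i)) {..Suc n}"]) (auto simp: cylinder_def traj_def)
  next
    fix \<xi> assume "\<xi> \<in> (\<Union>y\<in>PiE {..Suc n} (\<lambda>_. S). cylinder S (Suc n) y ?s)"
    then show "\<xi> \<in> {\<xi>\<in>space (traj_space S). max s 0 < snd (\<xi> n)}"
      by (auto simp: cylinder_def all_conj_distrib dest: spec[of _ n])
  qed
  also have "\<dots> \<in> sets (traj_space S)"
  proof (rule sets.countable_UN''[OF countable_cylinder_bases[OF assms]])
    show "cylinder S (Suc n) y ?s \<in> sets (traj_space S)" if "y \<in> PiE {..Suc n} (\<lambda>_. S)" for y
      by (rule cylinder_in_sets) (use that in \<open>auto dest: PiE_mem\<close>)
  qed
  finally show "{\<xi>\<in>space (traj_space S). s < snd (\<xi> n)} \<in> sets (traj_space S)" .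
qed

definition shift :: "(nat \<Rightarrow> 'a) \<Rightarrow> nat \<Rightarrow> 'a" where
  "shift \<xi> = (\<lambda>n. \<xi> (Suc n))"

lemma measurable_shift [measurable]:
  assumes "countable S"
  shows "shift \<in> measurable (traj_space S) (traj_space S)"
  using assms by (intro measurable_into_traj_space) (auto simp: shift_def traj_def)

section \<open>The Markov property at the first jump\<close>

definition traj_law :: "'s set \<Rightarrow> ('s \<Rightarrow> 's \<Rightarrow> real) \<Rightarrow> 's \<Rightarrow> (nat \<Rightarrow> 's \<times> real) measure \<Rightarrow> bool" where
  "traj_law S Q x N \<longleftrightarrow> prob_space N \<and> sets N = sets (traj_space S) \<and>
    (\<forall>n y s. (\<forall>i\<le>n. y i \<in> S) \<longrightarrow> (\<forall>i<n. 0 \<le> s i) \<longrightarrow>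
      measure N (cylinder S n y s) =
        (if y 0 = x then 1 else 0) *
        (\<Prod>i<n. jump_prob Q (y i) (y (Suc i)) * exp (- (- Q (y i) (y i)) * s i)))"

lemma traj_law_distr:
  assumes M: "prob_space M"
    and Y: "\<And>n. Y n \<in> measurable M (count_space S)"
    and H: "\<And>n. H n \<in> borel_measurable M"
    and pos: "\<And>n \<omega>. \<omega> \<in> space M \<Longrightarrow> 0 < H n \<omega>"
    and law: "jump_hold_law M S Q x Y H"
  shows "(\<lambda>\<omega> n. (Y n \<omega>, H n \<omega>)) \<in> measurable M (traj_space S)"
    and "traj_law S Q x (distr M (traj_space S) (\<lambda>\<omega> n. (Y n \<omega>, H n \<omega>)))"
proof -
  let ?f = "\<lambda>\<omega> n. (Y n \<omega>, H n \<omega>)"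
  show f: "?f \<in> measurable M (traj_space S)"
    using Y H pos by (intro measurable_into_traj_space) auto
  show "traj_law S Q x (distr M (traj_space S) ?f)"
    unfolding traj_law_def
  proof (intro conjI allI impI)
    show "prob_space (distr M (traj_space S) ?f)" using M f by (rule prob_space.prob_space_distr)
    fix n y and s :: "nat \<Rightarrow> real"
    assume ys: "\<forall>i\<le>n. y i \<in> S" "\<forall>i<n. 0 \<le> s i"
    have "?f -` cylinder S n y s \<inter> space M = {\<omega> \<in> space M. (\<forall>i\<le>n. Y i \<omega> = y i) \<and> (\<forall>i<n. s i < H i \<omega>)}"
      using pos measurable_space[OF Y] by (auto simp: cylinder_def traj_def)
    with law ys show "measure (distr M (traj_space S) ?f) (cylinder S n y s) = (if y 0 = x then 1 else 0) *
        (\<Prod>i<n. jump_prob Q (y i) (y (Suc i)) * exp (- (- Q (y i) (y i)) * s i))"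
      unfolding jump_hold_law_def by (subst measure_distr[OF f]) (auto intro!: cylinder_in_sets)
  qed simp
qed

text \<open>
  Two laws for the same rates are fixed, started at \<open>x\<close> and at \<open>b\<close>. On the event that the
  first jump goes to \<open>b\<close>, the first holding time and the remaining trajectory are independent, with
  laws \<open>exp_law (- Q x x)\<close> and \<open>N'\<close>. This is proved first for cylinders and tails, where it is
  the product formula, and then extended one factor at a time.
\<close>

locale first_jump =
  fixes S :: "'s set" and Q x b N N'
  assumes countable: "countable S" and x: "x \<in> S" and b: "b \<in> S" and rate: "Q x x < 0"
    and N: "traj_law S Q x N" and N': "traj_law S Q b N'"
begin

sublocale N: prob_space N using N by (simp add: traj_law_def)
sublocale N': prob_space N' using N' by (simp add: traj_law_def)

lemma sets_N [simp, measurable_cong]: "sets N = sets (traj_space S)" "sets N' = sets (traj_space S)"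
  using N N' by (simp_all add: traj_law_def)

lemma space_N [simp]: "space N = traj S" "space N' = traj S"
  using sets_eq_imp_space_eq[OF sets_N(1)] sets_eq_imp_space_eq[OF sets_N(2)] by simp_all

lemma state_measurable [measurable]: "(\<lambda>\<xi>. fst (\<xi> n)) \<in> measurable (traj_space S) (count_space S)"
  and hold_measurable [measurable]: "(\<lambda>\<xi>. snd (\<xi> n)) \<in> borel_measurable (traj_space S)"
  and shift_measurable [measurable]: "shift \<in> measurable (traj_space S) (traj_space S)"
  using countable by (rule measurable_traj_state measurable_traj_hold measurable_shift)+

text \<open>
  The number is the probability of a cylinder, whatever the sign of \<open>Q x b\<close>.
\<close>

lemma jump_prob_nonneg: "0 \<le> jump_prob Q x b"
proof -
  have "measure N (cylinder S 1 (case_nat x (\<lambda>_. b)) (\<lambda>_. 0)) = jump_prob Q x b"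
    using N x b by (subst traj_law_def[THEN iffD1, THEN conjunct2, THEN conjunct2, rule_format])
      (auto split: nat.splits)
  then show ?thesis by (metis measure_nonneg)
qed

lemma AE_start: "AE \<xi> in N. fst (\<xi> 0) = x"
proof -
  have "measure N (cylinder S 0 (\<lambda>_. x) (\<lambda>_. 0)) = 1"
    using N x by (subst traj_law_def[THEN iffD1, THEN conjunct2, THEN conjunct2, rule_format]) auto
  moreover have "cylinder S 0 (\<lambda>_. x) (\<lambda>_. 0) \<in> N.events" using x by (auto intro: cylinder_in_sets)
  ultimately have "AE \<xi> in N. \<xi> \<in> cylinder S 0 (\<lambda>_. x) (\<lambda>_. 0)" by (simp add: N.prob_eq_1)
  then show ?thesis by eventually_elim (simp add: cylinder_def)
qed

text \<open>
  Prefixing the state \<open>x\<close> and the threshold \<open>s\<close> turns the event into a longer cylinder, whose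
  probability has one more factor.
\<close>

lemma emeasure_jump_cylinder:
  assumes s: "0 \<le> s" and B: "B \<in> cylinders S"
  shows "emeasure N {\<xi>\<in>traj S. fst (\<xi> 1) = b \<and> s < snd (\<xi> 0) \<and> shift \<xi> \<in> B} =
    ennreal (jump_prob Q x b * exp (Q x x * s)) * emeasure N' B"
proof -
  from B consider "B = {}" | n y s' where "B = cylinder S n y s'" "\<forall>i\<le>n. y i \<in> S" "\<forall>i<n. 0 \<le> s' i"
    unfolding cylinders_def by auto
  then show ?thesis
  proof cases
    case 1 then show ?thesis by simp
  next
    case 2
    have [measurable]: "B \<in> sets (traj_space S)" using 2 by (auto intro: cylinder_in_sets)
    let ?E = "{\<xi>\<in>traj S. fst (\<xi> 1) = b \<and> s < snd (\<xi> 0) \<and> shift \<xi> \<in> B}"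
    have mB: "measure N' B = (if y 0 = b then 1 else 0) *
        (\<Prod>i<n. jump_prob Q (y i) (y (Suc i)) * exp (- (- Q (y i) (y i)) * s' i))"
      using N' 2 unfolding traj_law_def by blast
    show ?thesis
    proof (cases "y 0 = b")
      case False
      then have "?E = {}" using 2 by (auto simp: cylinder_def shift_def)
      moreover have "emeasure N' B = 0" using mB False by (simp add: N'.emeasure_eq_measure)
      ultimately show ?thesis by (simp only: emeasure_empty mult_zero_right)
    next
      case True
      let ?C = "cylinder S (Suc n) (case_nat x y) (case_nat s s')"
      have ys: "\<forall>i\<le>Suc n. case_nat x y i \<in> S" "\<forall>i<Suc n. 0 \<le> case_nat s s' i"
        using 2 x s by (auto split: nat.splits)
      have C: "\<xi> \<in> ?C \<longleftrightarrow> \<xi> \<in> ?E \<and> fst (\<xi> 0) = x" for \<xi>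
        using True 2 unfolding cylinder_def traj_def shift_def
        by (auto simp: less_Suc_eq_0_disj split: nat.splits)
      have "?E = {\<xi>\<in>space (traj_space S). fst (\<xi> 1) = b \<and> s < snd (\<xi> 0) \<and> shift \<xi> \<in> B}" by simp
      also have "\<dots> \<in> N.events" using b by measurable
      finally have E: "?E \<in> N.events" .
      have "emeasure N ?E = emeasure N ?C"
      proof (rule emeasure_eq_AE)
        show "AE \<xi> in N. (\<xi> \<in> ?E) = (\<xi> \<in> ?C)"
          using AE_start by eventually_elim (use C in blast)
        show "?C \<in> N.events" unfolding sets_N using ys by (intro cylinder_in_sets) auto
      qed (use E in auto)
      also have "measure N ?C = (if case_nat x y 0 = x then 1 else 0) *
        (\<Prod>i<Suc n. jump_prob Q (case_nat x y i) (case_nat x y (Suc i)) *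
          exp (- (- Q (case_nat x y i) (case_nat x y i)) * case_nat s s' i))"
        using N ys unfolding traj_law_def by blast
      then have "measure N ?C = jump_prob Q x b * exp (Q x x * s) * measure N' B"
        unfolding prod.lessThan_Suc_shift mB using True by simp
      then have "emeasure N ?C = ennreal (jump_prob Q x b * exp (Q x x * s)) * emeasure N' B"
        using jump_prob_nonneg
        by (simp add: N.emeasure_eq_measure N'.emeasure_eq_measure ennreal_mult)
      finally show ?thesis .
    qed
  qed
qed

text \<open>
  For fixed \<open>s\<close> both sides are finite measures in \<open>B\<close> that agree on the cylinders.
\<close>

lemma emeasure_jump_tail:
  assumes s: "0 \<le> s" and B: "B \<in> sets (traj_space S)"
  shows "emeasure N {\<xi>\<in>traj S. fst (\<xi> 1) = b \<and> s < snd (\<xi> 0) \<and> shift \<xi> \<in> B} =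
    ennreal (jump_prob Q x b * exp (Q x x * s)) * emeasure N' B"
proof -
  let ?C = "{\<xi>\<in>traj S. fst (\<xi> 1) = b \<and> s < snd (\<xi> 0)}"
  let ?c = "ennreal (jump_prob Q x b * exp (Q x x * s))"
  have "?C = {\<xi>\<in>space (traj_space S). fst (\<xi> 1) = b \<and> s < snd (\<xi> 0)}" by simp
  also have "\<dots> \<in> sets (traj_space S)" using b by measurable
  finally have C: "?C \<in> sets (traj_space S)" .
  have push: "emeasure (distr (restrict_space N ?C) (traj_space S) shift) A =
      emeasure N {\<xi>\<in>traj S. fst (\<xi> 1) = b \<and> s < snd (\<xi> 0) \<and> shift \<xi> \<in> A}"
    if A: "A \<in> sets (traj_space S)" for A
  proof -
    have "shift \<in> measurable (restrict_space N ?C) (traj_space S)"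
      by (intro measurable_restrict_space1) simp
    then have "emeasure (distr (restrict_space N ?C) (traj_space S) shift) A =
        emeasure (restrict_space N ?C) (shift -` A \<inter> ?C)"
      using C A by (subst emeasure_distr) (auto simp: space_restrict_space intro!: arg_cong2[where f=emeasure])
    also have "\<dots> = emeasure N (shift -` A \<inter> ?C)" 
      using sets.Int[OF C sets.top] by (subst emeasure_restrict_space) auto
    also have "shift -` A \<inter> ?C = {\<xi>\<in>traj S. fst (\<xi> 1) = b \<and> s < snd (\<xi> 0) \<and> shift \<xi> \<in> A}" by auto
    finally show ?thesis .
  qed
  have "distr (restrict_space N ?C) (traj_space S) shift = scale_measure ?c N'"
  proof (rule measure_eqI_generator_eq_countable[OF Int_stable_cylinders cylinders_Pow])
    fix A assume "A \<in> cylinders S"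
    then show "emeasure (distr (restrict_space N ?C) (traj_space S) shift) A = emeasure (scale_measure ?c N') A"
      using emeasure_jump_cylinder[OF s] by (subst push) (auto simp: sets_traj_space)
  next
    show "(\<lambda>z. cylinder S 0 (\<lambda>_. z) (\<lambda>_. 0)) ` S \<subseteq> cylinders S" by (auto simp: cylinders_def)
    show "\<Union> ((\<lambda>z. cylinder S 0 (\<lambda>_. z) (\<lambda>_. 0)) ` S) = traj S" by (auto simp: cylinder_def traj_def)
    fix A assume "A \<in> (\<lambda>z. cylinder S 0 (\<lambda>_. z) (\<lambda>_. 0)) ` S"
    then have "A \<in> sets (traj_space S)" by (auto intro: cylinder_in_sets)
    then show "emeasure (distr (restrict_space N ?C) (traj_space S) shift) A \<noteq> \<infinity>" by (subst push) auto
  qed (auto simp: sets_traj_space countable)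
  then show ?thesis using push[OF B] by simp
qed

text \<open>
  For fixed \<open>B\<close> both sides are finite measures in \<open>A\<close> that agree on the half-lines. Those with a
  negative end point reduce to \<open>s = 0\<close>, as holding times are positive.
\<close>

lemma emeasure_jump_rectangle:
  assumes A: "A \<in> sets borel" and B: "B \<in> sets (traj_space S)"
  shows "emeasure N {\<xi>\<in>traj S. fst (\<xi> 1) = b \<and> snd (\<xi> 0) \<in> A \<and> shift \<xi> \<in> B} =
    emeasure (exp_law (- Q x x)) A * (ennreal (jump_prob Q x b) * emeasure N' B)"
proof -
  interpret E: prob_space "exp_law (- Q x x)" using rate by (intro prob_space_exp_law) simp
  let ?C = "{\<xi>\<in>traj S. fst (\<xi> 1) = b \<and> shift \<xi> \<in> B}"
  let ?c = "ennreal (jump_prob Q x b) * emeasure N' B"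
  have "?C = {\<xi>\<in>space (traj_space S). fst (\<xi> 1) = b \<and> shift \<xi> \<in> B}" by simp
  also have "\<dots> \<in> sets (traj_space S)" using b B by measurable
  finally have C: "?C \<in> sets (traj_space S)" .
  let ?D = "distr (restrict_space N ?C) borel (\<lambda>\<xi>. snd (\<xi> 0))"
  have push: "emeasure ?D A = emeasure N {\<xi>\<in>traj S. fst (\<xi> 1) = b \<and> snd (\<xi> 0) \<in> A \<and> shift \<xi> \<in> B}"
    if A: "A \<in> sets borel" for A
  proof -
    have "(\<lambda>\<xi>. snd (\<xi> 0)) \<in> measurable (restrict_space N ?C) borel"
      by (intro measurable_restrict_space1) simp
    then have "emeasure ?D A = emeasure (restrict_space N ?C) ((\<lambda>\<xi>. snd (\<xi> 0)) -` A \<inter> ?C)"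
      using C A by (subst emeasure_distr) (auto simp: space_restrict_space intro!: arg_cong2[where f=emeasure])
    also have "\<dots> = emeasure N ((\<lambda>\<xi>. snd (\<xi> 0)) -` A \<inter> ?C)" 
      using sets.Int[OF C sets.top] by (subst emeasure_restrict_space) auto
    also have "(\<lambda>\<xi>. snd (\<xi> 0)) -` A \<inter> ?C = {\<xi>\<in>traj S. fst (\<xi> 1) = b \<and> snd (\<xi> 0) \<in> A \<and> shift \<xi> \<in> B}" by auto
    finally show ?thesis .
  qed
  have tail: "emeasure ?D {s<..} = ennreal (exp (Q x x * max s 0)) * ?c" for s
  proof -
    have "emeasure ?D {s<..} = emeasure N {\<xi>\<in>traj S. fst (\<xi> 1) = b \<and> max s 0 < snd (\<xi> 0) \<and> shift \<xi> \<in> B}"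
      by (subst push) (auto intro!: arg_cong2[where f=emeasure] simp: traj_def)
    also have "\<dots> = ennreal (exp (Q x x * max s 0)) * ?c"
      using emeasure_jump_tail[OF _ B, of "max s 0"] jump_prob_nonneg
      by (simp add: ennreal_mult mult_ac)
    finally show ?thesis .
  qed
  have "?D = scale_measure ?c (exp_law (- Q x x))"
  proof (rule measure_eqI_lessThan)
    show "emeasure ?D {s<..} < \<infinity>" for s by (subst push) (auto simp: less_top[symmetric])
    show "emeasure ?D {s<..} = emeasure (scale_measure ?c (exp_law (- Q x x))) {s<..}" for s
      unfolding tail using rate
      by (auto simp: E.emeasure_eq_measure measure_exp_law_greaterThan mult.commute max_def)
  qed auto
  then show ?thesis using push[OF A] by (simp add: mult.commute)
qed

lemma emeasure_first_jump:
  assumes X: "X \<in> sets (borel \<Otimes>\<^sub>M traj_space S)"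
  shows "emeasure N {\<xi>\<in>traj S. fst (\<xi> 1) = b \<and> (snd (\<xi> 0), shift \<xi>) \<in> X} =
    ennreal (jump_prob Q x b) * (\<integral>\<^sup>+h. emeasure N' (Pair h -` X) \<partial>exp_law (- Q x x))"
proof -
  interpret E: prob_space "exp_law (- Q x x)" using rate by (intro prob_space_exp_law) simp
  let ?C = "{\<xi>\<in>traj S. fst (\<xi> 1) = b}"
  let ?K = "scale_measure (ennreal (jump_prob Q x b)) N'"
  interpret K: finite_measure ?K
    by standard (simp add: space_scale_measure ennreal_mult_eq_top_iff)
  have "?C = {\<xi>\<in>space (traj_space S). fst (\<xi> 1) = b}" by simp
  also have "\<dots> \<in> sets (traj_space S)" using b by measurable
  finally have C: "?C \<in> sets (traj_space S)" .
  let ?D = "distr (restrict_space N ?C) (borel \<Otimes>\<^sub>M traj_space S) (\<lambda>\<xi>. (snd (\<xi> 0), shift \<xi>))"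
  have push: "emeasure ?D A = emeasure N {\<xi>\<in>traj S. fst (\<xi> 1) = b \<and> (snd (\<xi> 0), shift \<xi>) \<in> A}"
    if A: "A \<in> sets (borel \<Otimes>\<^sub>M traj_space S)" for A
  proof -
    have "(\<lambda>\<xi>. (snd (\<xi> 0), shift \<xi>)) \<in> measurable (restrict_space N ?C) (borel \<Otimes>\<^sub>M traj_space S)"
      by (intro measurable_restrict_space1) simp
    then have "emeasure ?D A = emeasure (restrict_space N ?C) ((\<lambda>\<xi>. (snd (\<xi> 0), shift \<xi>)) -` A \<inter> ?C)"
      using C A by (subst emeasure_distr) (auto simp: space_restrict_space intro!: arg_cong2[where f=emeasure])
    also have "\<dots> = emeasure N ((\<lambda>\<xi>. (snd (\<xi> 0), shift \<xi>)) -` A \<inter> ?C)" 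
      using sets.Int[OF C sets.top] by (subst emeasure_restrict_space) auto
    also have "(\<lambda>\<xi>. (snd (\<xi> 0), shift \<xi>)) -` A \<inter> ?C = {\<xi>\<in>traj S. fst (\<xi> 1) = b \<and> (snd (\<xi> 0), shift \<xi>) \<in> A}" by auto
    finally show ?thesis .
  qed
  have sets: "sets (exp_law (- Q x x) \<Otimes>\<^sub>M ?K) = sets (borel \<Otimes>\<^sub>M traj_space S)"
    by (intro sets_pair_measure_cong) simp_all
  have "exp_law (- Q x x) \<Otimes>\<^sub>M ?K = ?D"
  proof (rule pair_measure_eqI)
    fix A B assume "A \<in> sets (exp_law (- Q x x))" "B \<in> sets ?K"
    then show "emeasure (exp_law (- Q x x)) A * emeasure ?K B = emeasure ?D (A \<times> B)"
      using emeasure_jump_rectangle[of A B] by (subst push) auto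
  qed (use sets in \<open>auto intro: E.sigma_finite_measure_axioms K.sigma_finite_measure_axioms\<close>)
  then have "emeasure N {\<xi>\<in>traj S. fst (\<xi> 1) = b \<and> (snd (\<xi> 0), shift \<xi>) \<in> X} =
      emeasure (exp_law (- Q x x) \<Otimes>\<^sub>M ?K) X"
    using push[OF X] by simp
  also have "\<dots> = (\<integral>\<^sup>+h. emeasure ?K (Pair h -` X) \<partial>exp_law (- Q x x))"
    using X sets by (intro K.emeasure_pair_measure_alt) auto
  also have "\<dots> = ennreal (jump_prob Q x b) * (\<integral>\<^sup>+h. emeasure N' (Pair h -` X) \<partial>exp_law (- Q x x))"
  proof -
    have "X \<in> sets (exp_law (- Q x x) \<Otimes>\<^sub>M N')" using X by (subst sets_pair_measure_cong) auto
    then have "(\<lambda>h. emeasure N' (Pair h -` X)) \<in> borel_measurable (exp_law (- Q x x))"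
      by (rule N'.measurable_emeasure_Pair)
    then show ?thesis by (simp add: nn_integral_cmult)
  qed
  finally show ?thesis .
qed

end

section \<open>Observing the number of downward jumps and the state\<close>

lemma countable_half_ints: "countable half_ints"
proof -
  have "half_ints = range (\<lambda>k::int. of_int k + 1/2)" by (auto simp: half_ints_def)
  then show ?thesis by (metis countable_image countableI_type)
qed

lemma half_ints_add_int: "a \<in> half_ints \<Longrightarrow> a + of_int k \<in> half_ints"
proof -
  assume "a \<in> half_ints"
  then obtain j where "a = of_int j + 1/2" by (auto simp: half_ints_def)
  then have "a + of_int k = of_int (j + k) + 1/2" by simp
  then show ?thesis unfolding half_ints_def by blast
qed

lemma half_ints_plus_one [simp]: "a \<in> half_ints \<Longrightarrow> a + 1 \<in> half_ints"
  and half_ints_minus_one [simp]: "a \<in> half_ints \<Longrightarrow> a - 1 \<in> half_ints"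
  using half_ints_add_int[of a 1] half_ints_add_int[of a "-1"] by simp_all

lemma half_ints_minus_nat [simp]: "a \<in> half_ints \<Longrightarrow> a - real n \<in> half_ints"
  using half_ints_add_int[of a "- int n"] by simp

definition down_steps :: "(nat \<Rightarrow> real \<times> real) \<Rightarrow> nat \<Rightarrow> nat" where
  "down_steps \<xi> n = card {i. i < n \<and> fst (\<xi> (Suc i)) = fst (\<xi> i) - 1}"

text \<open>
  The event that at time \<open>t\<close> the number of downward jumps and the current state form a pair
  in \<open>A\<close>; \<open>n\<close> is the number of jumps made until then.
\<close>

definition obs_event :: "(nat \<times> real) set \<Rightarrow> real \<Rightarrow> (nat \<Rightarrow> real \<times> real) set" where
  "obs_event A t = {\<xi> \<in> traj half_ints. \<exists>n. (\<Sum>i<n. snd (\<xi> i)) \<le> t \<and> t < (\<Sum>i<Suc n. snd (\<xi> i)) \<and>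
     (down_steps \<xi> n, fst (\<xi> n)) \<in> A}"

lemma measurable_states [measurable]:
  "(\<lambda>\<xi>. fst (\<xi> n)) \<in> measurable (traj_space half_ints) (count_space half_ints)"
  "(\<lambda>\<xi>. snd (\<xi> n)) \<in> borel_measurable (traj_space half_ints)"
  using countable_half_ints by (rule measurable_traj_state, rule measurable_traj_hold)

lemma measurable_state_real [measurable]:
  "(\<lambda>\<xi>. fst (\<xi> n)) \<in> borel_measurable (traj_space half_ints)"
  by (rule measurable_compose[OF measurable_states(1)]) simp

lemma measurable_down_steps [measurable]:
  "(\<lambda>\<xi>. down_steps \<xi> n) \<in> measurable (traj_space half_ints) (count_space UNIV)"
  unfolding down_steps_def
proof (rule measurable_card)
  fix i
  have "{\<xi>\<in>space (traj_space half_ints). fst (\<xi> (Suc i)) = fst (\<xi> i) - 1} \<in> sets (traj_space half_ints)"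
    by (intro borel_measurable_eq borel_measurable_diff measurable_state_real borel_measurable_const)
  then show "{\<xi>\<in>space (traj_space half_ints). i \<in> {i. i < n \<and> fst (\<xi> (Suc i)) = fst (\<xi> i) - 1}}
      \<in> sets (traj_space half_ints)"
    by (cases "i < n") simp_all
qed

lemma measurable_observation [measurable]:
  "(\<lambda>\<xi>. (down_steps \<xi> n, fst (\<xi> n))) \<in> measurable (traj_space half_ints) (count_space (UNIV \<times> half_ints))"
proof -
  have "(\<lambda>\<xi>. (down_steps \<xi> n, fst (\<xi> n))) \<in>
      measurable (traj_space half_ints) (count_space UNIV \<Otimes>\<^sub>M count_space half_ints)"
    by measurable
  then show ?thesis by (simp add: pair_measure_countable countable_half_ints)
qed

text \<open>
  Joint measurability in the time and the trajectory is what allows the first holding time to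
  be integrated out.
\<close>

lemma measurable_obs_event_pair:
  assumes A: "A \<subseteq> UNIV \<times> half_ints"
  shows "{p \<in> space (borel \<Otimes>\<^sub>M traj_space half_ints). snd p \<in> obs_event A (t - fst p)}
    \<in> sets (borel \<Otimes>\<^sub>M traj_space half_ints)"
proof -
  have [measurable]: "Measurable.pred (borel \<Otimes>\<^sub>M traj_space half_ints) (\<lambda>p. (down_steps (snd p) n, fst (snd p n)) \<in> A)" for n
  proof -
    have "(\<lambda>p. (down_steps (snd p) n, fst (snd p n))) \<in>
        measurable (borel \<Otimes>\<^sub>M traj_space half_ints) (count_space (UNIV \<times> half_ints))"
      by (rule measurable_compose[OF measurable_snd measurable_observation])
    then show ?thesis by (rule measurable_compose) simp
  qed
  have [measurable]: "(\<lambda>p. snd (snd p i)) \<in> borel_measurable (borel \<Otimes>\<^sub>M traj_space half_ints)" for i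
    by (rule measurable_compose[OF measurable_snd measurable_states(2)])
  have "{p \<in> space (borel \<Otimes>\<^sub>M traj_space half_ints). snd p \<in> obs_event A (t - fst p)} =
    {p \<in> space (borel \<Otimes>\<^sub>M traj_space half_ints). \<exists>n. (\<Sum>i<n. snd (snd p i)) \<le> t - fst p \<and>
       t - fst p < (\<Sum>i<Suc n. snd (snd p i)) \<and> (down_steps (snd p) n, fst (snd p n)) \<in> A}"
    by (auto simp: obs_event_def space_pair_measure)
  also have "\<dots> \<in> sets (borel \<Otimes>\<^sub>M traj_space half_ints)" by measurable
  finally show ?thesis .
qed

lemma obs_event_sets [measurable]:
  assumes A: "A \<subseteq> UNIV \<times> half_ints"
  shows "obs_event A t \<in> sets (traj_space half_ints)"
  using sets_Pair1[OF measurable_obs_event_pair[OF A, of t], of 0]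
  by (rule back_subst[where P="\<lambda>X. X \<in> _"]) (auto simp: space_pair_measure obs_event_def)

lemma obs_event_neg: "t < 0 \<Longrightarrow> obs_event A t = {}"
proof (rule ccontr)
  assume t: "t < 0" and "obs_event A t \<noteq> {}"
  then obtain \<xi> n where "\<xi> \<in> traj half_ints" "(\<Sum>i<n. snd (\<xi> i)) \<le> t" by (auto simp: obs_event_def)
  then have "0 \<le> (\<Sum>i<n. snd (\<xi> i))" by (intro sum_nonneg) (auto simp: traj_def less_imp_le)
  then show False using \<open>_ \<le> t\<close> t by simp
qed

text \<open>
  If the first jump goes down, the remaining trajectory has to produce a pair in
  \<open>count_down A\<close> for the whole trajectory to produce one in \<open>A\<close>.
\<close>

definition count_down :: "(nat \<times> real) set \<Rightarrow> (nat \<times> real) set" where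
  "count_down A = {(d, z). (Suc d, z) \<in> A}"

lemma count_down_subset: "A \<subseteq> UNIV \<times> half_ints \<Longrightarrow> count_down A \<subseteq> UNIV \<times> half_ints"
  by (auto simp: count_down_def)

lemma down_steps_Suc:
  "down_steps \<xi> (Suc n) = (if fst (\<xi> 1) = fst (\<xi> 0) - 1 then Suc else id) (down_steps (shift \<xi>) n)"
proof -
  have "{i. i < Suc n \<and> fst (\<xi> (Suc i)) = fst (\<xi> i) - 1} =
      (if fst (\<xi> 1) = fst (\<xi> 0) - 1 then {0} else {}) \<union> Suc ` {i. i < n \<and> fst (shift \<xi> (Suc i)) = fst (shift \<xi> i) - 1}"
    by (auto simp: shift_def image_iff less_Suc_eq_0_disj)
  then show ?thesis
    unfolding down_steps_def by (auto simp: card_insert_if card_image)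
qed

text \<open>
  Either the first jump comes after \<open>t\<close>, or the trajectory after the first jump is observed
  at the remaining time. The alternatives exclude each other, since nothing is observed at
  a negative time (\<open>obs_event_neg\<close>).
\<close>

lemma obs_event_first_step:
  assumes \<xi>: "\<xi> \<in> traj half_ints" and t: "0 \<le> t"
    and b: "fst (\<xi> 1) = b" "b = fst (\<xi> 0) + 1 \<and> B = A \<or> b = fst (\<xi> 0) - 1 \<and> B = count_down A"
  shows "\<xi> \<in> obs_event A t \<longleftrightarrow>
    (t < snd (\<xi> 0) \<and> (0, fst (\<xi> 0)) \<in> A) \<or> shift \<xi> \<in> obs_event B (t - snd (\<xi> 0))"
proof -
  let ?P = "\<lambda>n. (\<Sum>i<n. snd (\<xi> i)) \<le> t \<and> t < (\<Sum>i<Suc n. snd (\<xi> i)) \<and> (down_steps \<xi> n, fst (\<xi> n)) \<in> A"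
  have "(\<exists>n. ?P n) \<longleftrightarrow> ?P 0 \<or> (\<exists>n. ?P (Suc n))" by (metis not0_implies_Suc)
  moreover have "?P 0 \<longleftrightarrow> t < snd (\<xi> 0) \<and> (0, fst (\<xi> 0)) \<in> A" using t by (simp add: down_steps_def)
  moreover have "?P (Suc n) \<longleftrightarrow> (\<Sum>i<n. snd (shift \<xi> i)) \<le> t - snd (\<xi> 0) \<and>
      t - snd (\<xi> 0) < (\<Sum>i<Suc n. snd (shift \<xi> i)) \<and> (down_steps (shift \<xi>) n, fst (shift \<xi> n)) \<in> B" for n
    using b unfolding down_steps_Suc unfolding sum.lessThan_Suc_shift
    by (auto simp: shift_def count_down_def algebra_simps simp del: sum.lessThan_Suc)
  ultimately show ?thesis using \<xi> by (auto simp: obs_event_def traj_def shift_def)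
qed

text \<open>
  The conditional probability of the observation \<open>A\<close> at time \<open>x\<close> for a chain started at \<open>a\<close>
  with first holding time \<open>h\<close>, where \<open>v\<close> is the corresponding probability, as a function of time,
  for the chain started afresh at the state after the first jump.
\<close>

definition given_hold :: "(nat \<times> real) set \<Rightarrow> real \<Rightarrow> (real \<Rightarrow> real) \<Rightarrow> real \<Rightarrow> real \<Rightarrow> real" where
  "given_hold A a v x h = (if x < h then indicator A (0, a) else v (x - h))"

section \<open>The renewal equation\<close>

locale odd_chain =
  fixes q :: real and N :: "real \<Rightarrow> (nat \<Rightarrow> real \<times> real) measure"
  assumes q: "2 \<le> q" and N: "a \<in> half_ints \<Longrightarrow> traj_law half_ints (Q_odd q) a (N a)"
begin

definition rate :: "real \<Rightarrow> real" where "rate a = q powr a + q powr (- a)"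
definition up :: "real \<Rightarrow> real" where "up a = q powr (- a) / rate a"
definition down :: "real \<Rightarrow> real" where "down a = q powr a / rate a"

definition obs_prob :: "real \<Rightarrow> (nat \<times> real) set \<Rightarrow> real \<Rightarrow> real" where
  "obs_prob a A t = measure (N a) (obs_event A t)"

lemma rate_pos: "0 < rate a" using q by (simp add: rate_def add_pos_pos)

lemma up_down: "0 \<le> up a" "0 \<le> down a" "up a + down a = 1"
  using rate_pos[of a] q by (auto simp: up_def down_def add_divide_distrib[symmetric] rate_def)

lemma Q_odd_diag: "- Q_odd q a a = rate a" by (simp add: Q_odd_def rate_def)

lemma jump_prob_odd:
  "jump_prob (Q_odd q) a b = (if b = a + 1 then up a else if b = a - 1 then down a else 0)"
  unfolding jump_prob_def Q_odd_diag by (auto simp: Q_odd_def up_def down_def)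

lemma first_jump_instance: "a \<in> half_ints \<Longrightarrow> b \<in> half_ints \<Longrightarrow> first_jump half_ints (Q_odd q) a b (N a) (N b)"
  using rate_pos[of a] Q_odd_diag[of a] by unfold_locales (auto intro: N countable_half_ints)

lemma prob_space_N: "a \<in> half_ints \<Longrightarrow> prob_space (N a)"
  and sets_N: "a \<in> half_ints \<Longrightarrow> sets (N a) = sets (traj_space half_ints)"
  using N by (auto simp: traj_law_def)

lemma obs_prob_bounds: "a \<in> half_ints \<Longrightarrow> 0 \<le> obs_prob a A t" "a \<in> half_ints \<Longrightarrow> obs_prob a A t \<le> 1"
  using prob_space.prob_le_1[OF prob_space_N] by (auto simp: obs_prob_def)

lemma measurable_obs_prob [measurable]:
  assumes a: "a \<in> half_ints" and A: "A \<subseteq> UNIV \<times> half_ints"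
  shows "obs_prob a A \<in> borel_measurable borel"
proof -
  interpret prob_space "N a" using a by (rule prob_space_N)
  let ?X = "{p \<in> space (borel \<Otimes>\<^sub>M traj_space half_ints). snd p \<in> obs_event A (0 - fst p)}"
  have "?X \<in> sets (borel \<Otimes>\<^sub>M N a)"
    using measurable_obs_event_pair[OF A, of 0] sets_pair_measure_cong[OF refl sets_N[OF a]] by blast
  then have "(\<lambda>h. measure (N a) (Pair h -` ?X)) \<in> borel_measurable borel"
    unfolding measure_def by (intro borel_measurable_enn2real measurable_emeasure_Pair)
  moreover have "Pair h -` ?X = obs_event A (- h)" for h
    by (auto simp: space_pair_measure obs_event_def)
  ultimately have "(\<lambda>h. obs_prob a A (- h)) \<in> borel_measurable borel" by (simp add: obs_prob_def)
  from measurable_compose[OF borel_measurable_uminus[OF measurable_ident] this]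
  have "(\<lambda>t. obs_prob a A (- (- t))) \<in> borel_measurable borel" by simp
  then show ?thesis by simp
qed

lemma measurable_given_hold [measurable]:
  "b \<in> half_ints \<Longrightarrow> A' \<subseteq> UNIV \<times> half_ints \<Longrightarrow> given_hold A a (obs_prob b A') x \<in> borel_measurable borel"
  unfolding given_hold_def using measurable_obs_prob[of b A'] by measurable

lemma given_hold_bounds:
  assumes "b \<in> half_ints" shows "0 \<le> given_hold A a (obs_prob b A') x h" "given_hold A a (obs_prob b A') x h \<le> 1"
  using obs_prob_bounds[OF assms] by (auto simp: given_hold_def indicator_def)

lemma AE_first_state:
  assumes a: "a \<in> half_ints"
  shows "AE \<xi> in N a. fst (\<xi> 0) = a \<and> (fst (\<xi> 1) = a + 1 \<or> fst (\<xi> 1) = a - 1)"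
proof -
  interpret A: first_jump half_ints "Q_odd q" a a "N a" "N a" using a a by (rule first_jump_instance)
  have "AE \<xi> in N a. \<forall>b\<in>half_ints - {a + 1, a - 1}. fst (\<xi> 1) \<noteq> b"
  proof (subst AE_ball_countable)
    show "\<forall>b\<in>half_ints - {a + 1, a - 1}. AE \<xi> in N a. fst (\<xi> 1) \<noteq> b"
    proof
      fix b assume b: "b \<in> half_ints - {a + 1, a - 1}"
      then interpret B: first_jump half_ints "Q_odd q" a b "N a" "N b" using a by (intro first_jump_instance) auto
      have "emeasure (N a) {\<xi>\<in>traj half_ints. fst (\<xi> 1) = b \<and> 0 < snd (\<xi> 0) \<and> shift \<xi> \<in> traj half_ints} = 0"
        using b by (subst B.emeasure_jump_tail) (auto simp: jump_prob_odd sets.top[of "traj_space half_ints", simplified])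
      also have "{\<xi>\<in>traj half_ints. fst (\<xi> 1) = b \<and> 0 < snd (\<xi> 0) \<and> shift \<xi> \<in> traj half_ints} =
          {\<xi>\<in>space (N a). \<not> fst (\<xi> 1) \<noteq> b}" by (auto simp: traj_def shift_def)
      finally have "emeasure (N a) {\<xi>\<in>space (N a). \<not> fst (\<xi> 1) \<noteq> b} = 0" .
      moreover have "{\<xi>\<in>space (traj_space half_ints). fst (\<xi> 1) = b} \<in> sets (traj_space half_ints)"
        by (intro borel_measurable_eq measurable_state_real borel_measurable_const)
      ultimately show "AE \<xi> in N a. fst (\<xi> 1) \<noteq> b"
        by (intro AE_I[where N="{\<xi>\<in>space (N a). \<not> fst (\<xi> 1) \<noteq> b}"]) auto
    qed
  qed (use countable_half_ints in auto)
  with A.AE_start AE_space show ?thesis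
    by eventually_elim (auto simp: traj_def)
qed

text \<open>
  Conditioning on the first jump: its time has law \<open>exp_law (rate a)\<close>, and
  independently it goes up or down with probabilities \<open>up a\<close> and \<open>down a\<close>.
\<close>

lemma obs_prob_first_step:
  assumes a: "a \<in> half_ints" and A: "A \<subseteq> UNIV \<times> half_ints" and t: "0 \<le> t"
  shows "obs_prob a A t =
    up a * (\<integral>h. given_hold A a (obs_prob (a + 1) A) t h \<partial>exp_law (rate a)) +
    down a * (\<integral>h. given_hold A a (obs_prob (a - 1) (count_down A)) t h \<partial>exp_law (rate a))"
proof -
  note cd = count_down_subset[OF A]
  interpret A: first_jump half_ints "Q_odd q" a a "N a" "N a" using a a by (rule first_jump_instance)
  \<comment> \<open>The part of the observation event on which the first jump goes to \<open>b\<close>.\<close>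
  define E where "E b B = {\<xi>\<in>traj half_ints. fst (\<xi> 1) = b \<and>
    ((t < snd (\<xi> 0) \<and> (0, a) \<in> A) \<or> shift \<xi> \<in> obs_event B (t - snd (\<xi> 0)))}" for b B
  have branch: "E b B \<in> A.N.events \<and> measure (N a) (E b B) =
      jump_prob (Q_odd q) a b * (\<integral>h. given_hold A a (obs_prob b B) t h \<partial>exp_law (rate a))"
    if b: "b \<in> half_ints" and B: "B \<subseteq> UNIV \<times> half_ints" for b B
  proof -
    interpret B: first_jump half_ints "Q_odd q" a b "N a" "N b" using a b by (rule first_jump_instance)
    define W where "W = given_hold A a (obs_prob b B) t"
    define X where "X = {p \<in> space (borel \<Otimes>\<^sub>M traj_space half_ints).
      (t < fst p \<and> (0, a) \<in> A) \<or> snd p \<in> obs_event B (t - fst p)}"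
    have X: "X \<in> sets (borel \<Otimes>\<^sub>M traj_space half_ints)"
    proof -
      have "{p \<in> space (borel \<Otimes>\<^sub>M traj_space half_ints). t < fst p \<and> (0, a) \<in> A} \<in> sets (borel \<Otimes>\<^sub>M traj_space half_ints)"
        by measurable
      from sets.Un[OF this measurable_obs_event_pair[OF B, of t]] show ?thesis
        by (rule back_subst[where P="\<lambda>X. X \<in> _"]) (auto simp: X_def)
    qed
    have E: "E b B = {\<xi>\<in>traj half_ints. fst (\<xi> 1) = b \<and> (snd (\<xi> 0), shift \<xi>) \<in> X}"
      by (auto simp: E_def X_def space_pair_measure traj_def shift_def)
    have W [measurable]: "W \<in> borel_measurable borel"
      unfolding W_def using b B by (rule measurable_given_hold)
    have W01: "0 \<le> W h" "W h \<le> 1" for h unfolding W_def using b by (rule given_hold_bounds)+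
    have sec: "emeasure (N b) (Pair h -` X) = ennreal (W h)" for h
    proof (cases "t < h")
      case True
      then have "obs_event B (t - h) = {}" by (intro obs_event_neg) simp
      with True have "Pair h -` X = (if (0, a) \<in> A then space (N b) else {})"
        by (auto simp: X_def space_pair_measure)
      then show ?thesis using True B.N'.emeasure_space_1 by (auto simp: W_def given_hold_def indicator_def)
    next
      case False
      then have "Pair h -` X = obs_event B (t - h)"
        by (auto simp: X_def space_pair_measure obs_event_def)
      then show ?thesis using False by (simp add: W_def given_hold_def obs_prob_def B.N'.emeasure_eq_measure)
    qed
    have ev: "E b B \<in> A.N.events"
    proof -
      have "(\<lambda>\<xi>. (snd (\<xi> 0), shift \<xi>)) -` X \<inter> space (traj_space half_ints) \<in> sets (traj_space half_ints)"
        by (rule measurable_sets[OF measurable_Pair[OF B.hold_measurable B.shift_measurable] X])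
      moreover have "{\<xi>\<in>space (traj_space half_ints). fst (\<xi> 1) = b} \<in> sets (traj_space half_ints)"
        by (intro borel_measurable_eq measurable_state_real borel_measurable_const)
      ultimately have "((\<lambda>\<xi>. (snd (\<xi> 0), shift \<xi>)) -` X \<inter> space (traj_space half_ints)) \<inter>
          {\<xi>\<in>space (traj_space half_ints). fst (\<xi> 1) = b} \<in> A.N.events"
        by (simp only: A.sets_N) (rule sets.Int)
      also have "((\<lambda>\<xi>. (snd (\<xi> 0), shift \<xi>)) -` X \<inter> space (traj_space half_ints)) \<inter>
          {\<xi>\<in>space (traj_space half_ints). fst (\<xi> 1) = b} = E b B"
        unfolding E by auto
      finally show ?thesis .
    qed
    have Wi: "integrable (exp_law (rate a)) W"
      using W01 by (intro integrable_exp_law_bounded[where B=1] rate_pos W) simp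
    have W_nonneg: "0 \<le> (\<integral>h. W h \<partial>exp_law (rate a))"
      using W01 by (intro integral_nonneg_AE AE_I2)
    have "emeasure (N a) (E b B) = ennreal (jump_prob (Q_odd q) a b) * (\<integral>\<^sup>+h. ennreal (W h) \<partial>exp_law (rate a))"
      unfolding E B.emeasure_first_jump[OF X] sec Q_odd_diag ..
    also have "(\<integral>\<^sup>+h. ennreal (W h) \<partial>exp_law (rate a)) = ennreal (\<integral>h. W h \<partial>exp_law (rate a))"
      using W01 Wi by (intro nn_integral_eq_integral AE_I2)
    also have "ennreal (jump_prob (Q_odd q) a b) * ennreal (\<integral>h. W h \<partial>exp_law (rate a)) =
        ennreal (jump_prob (Q_odd q) a b * (\<integral>h. W h \<partial>exp_law (rate a)))"
      by (rule ennreal_mult[OF B.jump_prob_nonneg W_nonneg, symmetric])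
    finally have "measure (N a) (E b B) = jump_prob (Q_odd q) a b * (\<integral>h. W h \<partial>exp_law (rate a))"
      using mult_nonneg_nonneg[OF B.jump_prob_nonneg W_nonneg] unfolding measure_def by (simp only: enn2real_ennreal)
    with ev show ?thesis unfolding W_def by blast
  qed
  define U where "U = E (a + 1) A"
  define D where "D = E (a - 1) (count_down A)"
  note U = branch[OF half_ints_plus_one[OF a] A, folded U_def]
  note D = branch[OF half_ints_minus_one[OF a] cd, folded D_def]
  have "obs_prob a A t = measure (N a) (U \<union> D)"
    unfolding obs_prob_def
  proof (rule measure_eq_AE)
    show "AE \<xi> in N a. (\<xi> \<in> obs_event A t) = (\<xi> \<in> U \<union> D)"
      using AE_first_state[OF a] AE_space
    proof eventually_elim
      case (elim \<xi>)
      then have \<xi>: "\<xi> \<in> traj half_ints" by simp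
      from elim(1) show ?case
      proof (elim conjE disjE)
        assume s: "fst (\<xi> 0) = a" "fst (\<xi> 1) = a + 1"
        then show ?thesis
          using \<xi> obs_event_first_step[OF \<xi> t s(2), of A A] by (simp add: U_def D_def E_def)
      next
        assume s: "fst (\<xi> 0) = a" "fst (\<xi> 1) = a - 1"
        then show ?thesis
          using \<xi> obs_event_first_step[OF \<xi> t s(2), of "count_down A" A] by (simp add: U_def D_def E_def)
      qed
    qed
    show "obs_event A t \<in> A.N.events" using obs_event_sets[OF A] by simp
    show "U \<union> D \<in> A.N.events" by (rule sets.Un[OF conjunct1[OF U] conjunct1[OF D]])
  qed
  also have "\<dots> = measure (N a) U + measure (N a) D"
  proof (rule A.N.finite_measure_Union[OF conjunct1[OF U] conjunct1[OF D]])
    show "U \<inter> D = {}" unfolding U_def D_def E_def by fastforce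
  qed
  finally show ?thesis unfolding conjunct2[OF U] conjunct2[OF D] jump_prob_odd by simp
qed

section \<open>Rapid ascent from far below\<close>

lemma rate_ge: "q powr (- a) \<le> rate a"
  using q by (simp add: rate_def)

lemma down_le: "down a \<le> q powr (2 * a)"
proof -
  have "down a \<le> q powr a / q powr (- a)"
    unfolding down_def using q rate_pos by (intro divide_left_mono rate_ge) auto
  also have "\<dots> = q powr (2 * a)" using q by (simp add: powr_diff[symmetric])
  finally show ?thesis .
qed

lemma powr_minus_nat_le: "q powr (x - real n) \<le> q powr x * (1 / 2) ^ n"
proof -
  have "q powr (x - real n) = q powr x / q ^ n" using q by (simp add: powr_diff powr_realpow)
  also have "\<dots> \<le> q powr x / 2 ^ n" using q by (intro divide_left_mono power_mono mult_pos_pos) auto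
  finally show ?thesis by (simp add: power_one_over)
qed

text \<open>
  Here \<open>d n x\<close> is a quantity attached to the level \<open>b - n\<close> and the time
  \<open>x\<close>. The hypothesis \<open>step\<close> says that it is at most 1 if the chain has not left the
  level by time \<open>x\<close>, and otherwise is inherited from the next level up, except for an error when
  the first jump goes down. If \<open>T\<close> denotes the passage time from \<open>b - n\<close> to
  \<open>b\<close>, the bound at level \<open>b\<close> is to be averaged over \<open>x - T\<close>: the
  constant is kept, \<open>\<beta> * (t - x)\<close> increases by \<open>\<beta>\<close> times the mean of
  \<open>T\<close>, which is at most \<open>q powr b\<close>, the errors from downward jumps add up to at most
  \<open>q powr (2 * b)\<close>, and the exponential term is multiplied by the exponential moment of
  \<open>T\<close>, which is at most 2 as \<open>l\<close> is at most half the holding rate at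
  \<open>b\<close>. Since \<open>1 \<le> \<gamma>\<close>, the exponential term also covers the case that
  \<open>b\<close> is not reached by time \<open>x\<close>: it exceeds 1 when continued to negative times.
\<close>

lemma propagate_down_levels:
  fixes d :: "nat \<Rightarrow> real \<Rightarrow> real"
  assumes step: "\<And>n x g. 0 \<le> x \<Longrightarrow> x \<le> t \<Longrightarrow> integrable (exp_law (rate (b - real (Suc n)))) g \<Longrightarrow>
      (\<And>h. 0 \<le> h \<Longrightarrow> (if x < h then 1 else down (b - real (Suc n)) + \<bar>d n (x - h)\<bar>) \<le> g h) \<Longrightarrow>
      \<bar>d (Suc n) x\<bar> \<le> (\<integral>h. g h \<partial>exp_law (rate (b - real (Suc n))))"
    and base: "\<And>x. 0 \<le> x \<Longrightarrow> x \<le> t \<Longrightarrow> \<bar>d 0 x\<bar> \<le> \<alpha> + \<beta> * (t - x) + \<gamma> * exp (- l * x)"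
    and param: "0 \<le> \<alpha>" "0 \<le> \<beta>" "1 \<le> \<gamma>" "0 \<le> l" "l \<le> q powr (- b) / 2"
    and x: "0 \<le> x" "x \<le> t"
  shows "\<bar>d n x\<bar> \<le> \<alpha> + (\<beta> * q powr b + q powr (2 * b)) + \<beta> * (t - x) + 2 * \<gamma> * exp (- l * x)"
proof -
  define C where "C = \<beta> * q powr b + q powr (2 * b)"
  have C: "0 \<le> C" using param by (simp add: C_def)
  \<comment> \<open>The exponential moments multiply up to the product of \<open>r / (r - l)\<close> over the levels passed;
    \<open>2 / (1 + (1 / 2) ^ n)\<close> dominates this product, as it grows by at least that factor at each step.\<close>
  have "\<bar>d n x\<bar> \<le> \<alpha> + C * (1 - (1 / 2) ^ n) + \<beta> * (t - x) + \<gamma> * (2 / (1 + (1 / 2) ^ n)) * exp (- l * x)"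
    using x
  proof (induction n arbitrary: x)
    case 0
    then show ?case using base[of x] by simp
  next
    case (Suc n)
    define a where "a = b - real (Suc n)"
    define r where "r = rate a"
    define p where "p = (1 / 2 :: real) ^ Suc n"
    define K where "K = \<gamma> * (2 / (1 + 2 * p))"
    have p: "0 < p" "p \<le> 1 / 2" by (simp_all add: p_def power_le_one)
    have p2: "(1 / 2) ^ n = 2 * p" by (simp add: p_def)
    have K: "1 \<le> K"
      using p param mult_mono[of 1 \<gamma> 1 "2 / (1 + 2 * p)"] by (simp add: K_def)
    have inv: "1 / r \<le> q powr b * p"
    proof -
      have "1 / r \<le> 1 / q powr (- a)"
        unfolding r_def using q rate_pos by (intro divide_left_mono rate_ge) auto
      also have "\<dots> = q powr (b - real (Suc n))" by (simp add: a_def powr_minus_divide[symmetric])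
      also have "\<dots> \<le> q powr b * p" unfolding p_def by (rule powr_minus_nat_le)
      finally show ?thesis .
    qed
    have dn: "down a \<le> q powr (2 * b) * p"
    proof -
      have "down a \<le> q powr (2 * b - real (2 * Suc n))"
        using down_le[of a] by (simp add: a_def algebra_simps)
      also have "\<dots> \<le> q powr (2 * b) * (1 / 2) ^ (2 * Suc n)" by (rule powr_minus_nat_le)
      also have "\<dots> \<le> q powr (2 * b) * p"
        unfolding p_def by (intro mult_left_mono power_decreasing) auto
      finally show ?thesis .
    qed
    have r: "0 < r" unfolding r_def by (rule rate_pos)
    have lr: "l \<le> r * p / 2"
    proof -
      have "q powr (- b) = 1 / q powr b" by (simp add: powr_minus_divide)
      also have "\<dots> \<le> r * p" using inv r q by (simp add: field_simps)
      finally show ?thesis using param(5) by simp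
    qed
    have "r * p \<le> r * (1 / 2)" using r p by (intro mult_left_mono) auto
    then have l: "l < r" using lr r by linarith
    let ?g = "\<lambda>h. (down a + \<alpha> + C * (1 - 2 * p) + \<beta> * (t - x)) + \<beta> * h + K * exp (- l * x) * exp (l * h)"
    interpret E: prob_space "exp_law r" using r by (rule prob_space_exp_law)
    have g: "integrable (exp_law r) ?g"
      using exp_law_ith_moment_one(1)[OF r] exp_law_exp_moment(1)[OF r l] by simp
    \<comment> \<open>One formula bounds both cases: for \<open>h > x\<close> its last term alone is at least 1.\<close>
    have le: "(if x < h then 1 else down a + \<bar>d n (x - h)\<bar>) \<le> ?g h" if h: "0 \<le> h" for h
    proof (cases "x < h")
      case True
      have "1 * 1 \<le> K * exp (l * (h - x))"
        using K True param by (intro mult_mono) auto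
      moreover have "exp (l * (h - x)) = exp (- l * x) * exp (l * h)"
        by (simp add: exp_add[symmetric] algebra_simps)
      moreover have "0 \<le> C * (1 - 2 * p)" "0 \<le> \<beta> * (t - x)" "0 \<le> \<beta> * h"
        using C p h Suc.prems param by simp_all
      ultimately show ?thesis using True up_down(2)[of a] param by (simp add: mult.assoc)
    next
      case False
      have "\<bar>d n (x - h)\<bar> \<le> \<alpha> + C * (1 - 2 * p) + \<beta> * (t - (x - h)) + K * exp (- l * (x - h))"
        using Suc.IH[of "x - h"] Suc.prems False h unfolding p2 K_def by simp
      also have "exp (- l * (x - h)) = exp (- l * x) * exp (l * h)"
        by (simp add: exp_add[symmetric] algebra_simps)
      finally show ?thesis using False by (simp add: algebra_simps)
    qed
    have "\<bar>d (Suc n) x\<bar> \<le> (\<integral>h. ?g h \<partial>exp_law r)"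
      using step[of x n ?g] Suc.prems g le unfolding r_def a_def by blast
    also have "\<dots> = (down a + \<alpha> + C * (1 - 2 * p) + \<beta> * (t - x)) + \<beta> * (1 / r) + K * exp (- l * x) * (r / (r - l))"
      using exp_law_ith_moment_one[OF r] exp_law_exp_moment[OF r l] E.prob_space by simp
    also have "\<dots> \<le> \<alpha> + C * (1 - p) + \<beta> * (t - x) + \<gamma> * (2 / (1 + p)) * exp (- l * x)"
    proof -
      have "down a + \<beta> * (1 / r) \<le> q powr (2 * b) * p + \<beta> * (q powr b * p)"
        using dn inv param by (intro add_mono mult_left_mono) auto
      also have "\<dots> = C * p" by (simp add: C_def algebra_simps)
      finally have 1: "down a + \<beta> * (1 / r) \<le> C * p" .
      have "l * (1 + 2 * p) \<le> (r * p / 2) * 2"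
        using lr p param r by (intro mult_mono) auto
      then have "r * (1 + p) \<le> (r - l) * (1 + 2 * p)" by (simp add: algebra_simps)
      then have "r \<le> (r - l) * (1 + 2 * p) / (1 + p)" using p by (simp add: pos_le_divide_eq)
      moreover have "0 < (r - l) * (1 + 2 * p)" using l p by (intro mult_pos_pos) auto
      ultimately have "2 * r / ((r - l) * (1 + 2 * p)) \<le> 2 / (1 + p)"
        by (simp only: pos_divide_le_eq) simp
      then have "2 / (1 + 2 * p) * (r / (r - l)) \<le> 2 / (1 + p)" by (simp add: mult.commute)
      then have "(\<gamma> * exp (- l * x)) * (2 / (1 + 2 * p) * (r / (r - l))) \<le> (\<gamma> * exp (- l * x)) * (2 / (1 + p))"
        using param by (intro mult_left_mono) auto
      then have 2: "K * exp (- l * x) * (r / (r - l)) \<le> \<gamma> * (2 / (1 + p)) * exp (- l * x)"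
        by (simp add: K_def mult_ac)
      from 1 2 show ?thesis by (simp add: algebra_simps)
    qed
    finally show ?case by (simp only: p_def)
  qed
  also have "\<dots> \<le> \<alpha> + C + \<beta> * (t - x) + 2 * \<gamma> * exp (- l * x)"
  proof -
    have "C * (1 - (1 / 2) ^ n) \<le> C * 1" using C by (intro mult_left_mono) auto
    moreover have "2 / (1 + (1 / 2) ^ n) \<le> (2 :: real)"
      by (simp add: divide_le_eq)
    then have "(\<gamma> * exp (- l * x)) * (2 / (1 + (1 / 2) ^ n)) \<le> (\<gamma> * exp (- l * x)) * 2"
      using param by (intro mult_left_mono) auto
    ultimately show ?thesis by (simp add: mult_ac)
  qed
  finally show ?thesis by (simp add: C_def)
qed

text \<open>
  Differences of two solutions of the renewal equation satisfy the hypothesis \<open>step\<close> of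
  \<open>propagate_down_levels\<close>. \<open>F\<close> and \<open>G\<close> are the differences of the integrands for a first jump
  upwards and downwards. A downward jump is rare, so for \<open>G\<close> the bound 1 suffices.
\<close>

lemma first_step_difference_le:
  fixes F G d g :: "real \<Rightarrow> real"
  assumes [measurable]: "F \<in> borel_measurable borel" "G \<in> borel_measurable borel"
    and FG: "\<And>h. \<bar>F h\<bar> \<le> 1" "\<And>h. \<bar>G h\<bar> \<le> 1"
    and F: "\<And>h. 0 \<le> h \<Longrightarrow> h \<le> x \<Longrightarrow> F h = d (x - h)"
    and g: "integrable (exp_law (rate a)) g"
    and le: "\<And>h. 0 \<le> h \<Longrightarrow> (if x < h then 1 else down a + \<bar>d (x - h)\<bar>) \<le> g h"
  shows "\<bar>up a * (\<integral>h. F h \<partial>exp_law (rate a)) + down a * (\<integral>h. G h \<partial>exp_law (rate a))\<bar>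
    \<le> (\<integral>h. g h \<partial>exp_law (rate a))"
proof -
  have iF: "integrable (exp_law (rate a)) F"
    using FG(1) by (intro integrable_exp_law_bounded[OF rate_pos]) auto
  have iG: "integrable (exp_law (rate a)) G"
    using FG(2) by (intro integrable_exp_law_bounded[OF rate_pos]) auto
  have "up a * (\<integral>h. F h \<partial>exp_law (rate a)) + down a * (\<integral>h. G h \<partial>exp_law (rate a)) =
      (\<integral>h. up a * F h + down a * G h \<partial>exp_law (rate a))"
    using iF iG by simp
  moreover have "\<bar>\<integral>h. up a * F h + down a * G h \<partial>exp_law (rate a)\<bar> \<le>
      (\<integral>h. \<bar>up a * F h + down a * G h\<bar> \<partial>exp_law (rate a))"
    by (rule integral_abs_bound)
  moreover have "\<dots> \<le> (\<integral>h. g h \<partial>exp_law (rate a))"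
  proof (rule integral_mono_AE)
    show "AE h in exp_law (rate a). \<bar>up a * F h + down a * G h\<bar> \<le> g h"
      using AE_exp_law_nonneg
    proof eventually_elim
      case (elim h)
      have "\<bar>up a * F h + down a * G h\<bar> \<le> up a * \<bar>F h\<bar> + down a * \<bar>G h\<bar>"
        using up_down[of a] by (intro order.trans[OF abs_triangle_ineq]) (simp add: abs_mult)
      also have "\<dots> \<le> (if x < h then 1 else down a + \<bar>d (x - h)\<bar>)"
      proof (cases "x < h")
        case True
        have "up a * \<bar>F h\<bar> + down a * \<bar>G h\<bar> \<le> up a * 1 + down a * 1"
          using up_down FG by (intro add_mono mult_left_mono)
        then show ?thesis using True up_down(3)[of a] by simp
      next
        case False
        have "up a * \<bar>F h\<bar> + down a * \<bar>G h\<bar> \<le> 1 * \<bar>F h\<bar> + down a * 1"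
          using up_down[of a] FG(2) by (intro add_mono mult_right_mono mult_left_mono) auto
        then show ?thesis using False F[OF elim] by simp
      qed
      also have "\<dots> \<le> g h" using elim by (rule le)
      finally show ?case .
    qed
  qed (use iF iG g in auto)
  ultimately show ?thesis by linarith
qed

lemma integrable_given_hold:
  assumes "b \<in> half_ints" "B \<subseteq> UNIV \<times> half_ints"
  shows "integrable (exp_law (rate a)) (given_hold A a (obs_prob b B) x)"
  using given_hold_bounds[OF assms(1)] assms
  by (intro integrable_exp_law_bounded[where B=1] rate_pos measurable_given_hold) auto

text \<open>
  A shift in time amounts to a shift of the first holding time, so it is absorbed by the
  exponential law of rate \<open>rate a\<close>.
\<close>

lemma obs_prob_lipschitz:
  assumes a: "a \<in> half_ints" and A: "A \<subseteq> UNIV \<times> half_ints" and x: "0 \<le> x" and s: "0 \<le> s"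
  shows "\<bar>obs_prob a A (x + s) - obs_prob a A x\<bar> \<le> rate a * s"
proof -
  have shift: "\<bar>(\<integral>h. given_hold A a (obs_prob b B) (x + s) h \<partial>exp_law (rate a)) - (\<integral>h. given_hold A a (obs_prob b B) x h \<partial>exp_law (rate a))\<bar> \<le> rate a * s"
    if b: "b \<in> half_ints" and B: "B \<subseteq> UNIV \<times> half_ints" for b B
  proof -
    have "given_hold A a (obs_prob b B) (x + s) (s + h) = given_hold A a (obs_prob b B) x h" for h
      by (simp add: given_hold_def algebra_simps)
    with exp_law_shift_le[OF rate_pos s measurable_given_hold[OF b B, of A a "x + s"] given_hold_bounds[OF b], of a]
    show ?thesis by simp
  qed
  let ?I = "\<lambda>b B y. \<integral>h. given_hold A a (obs_prob b B) y h \<partial>exp_law (rate a)"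
  have eq: "obs_prob a A (x + s) - obs_prob a A x = up a * (?I (a + 1) A (x + s) - ?I (a + 1) A x) +
      down a * (?I (a - 1) (count_down A) (x + s) - ?I (a - 1) (count_down A) x)"
    using x s by (simp add: obs_prob_first_step[OF a A] algebra_simps)
  have "\<bar>obs_prob a A (x + s) - obs_prob a A x\<bar> \<le> up a * \<bar>?I (a + 1) A (x + s) - ?I (a + 1) A x\<bar> +
      down a * \<bar>?I (a - 1) (count_down A) (x + s) - ?I (a - 1) (count_down A) x\<bar>"
    unfolding eq using up_down[of a] by (intro order.trans[OF abs_triangle_ineq]) (simp add: abs_mult)
  also have "\<dots> \<le> up a * (rate a * s) + down a * (rate a * s)"
    using up_down[of a] a A count_down_subset[OF A] by (intro add_mono mult_left_mono shift) simp_all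
  also have "\<dots> = rate a * s" by (simp add: distrib_right[symmetric] up_down)
  finally show ?thesis .
qed

text \<open>
  The estimate \<open>obs_prob_lipschitz\<close> at the level \<open>c\<close> is carried down to all lower levels. Its
  constant remains \<open>rate c\<close>, where a direct application would give the much larger rate at the
  starting level.
\<close>

lemma obs_prob_time_regularity:
  assumes c: "c \<in> half_ints" and A: "A \<subseteq> UNIV \<times> half_ints" and x: "0 \<le> x" and s: "0 \<le> s"
  shows "\<bar>obs_prob (c - real n) A (x + s) - obs_prob (c - real n) A x\<bar> \<le>
    rate c * s + q powr (2 * c) + 2 * exp (- (q powr (- c) / 2) * x)"
proof -
  have "\<bar>obs_prob (c - real n) A (x + s) - obs_prob (c - real n) A x\<bar> \<le>
    rate c * s + (0 * q powr c + q powr (2 * c)) + 0 * (x - x) + 2 * 1 * exp (- (q powr (- c) / 2) * x)"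
  proof (rule propagate_down_levels[where d="\<lambda>n x. obs_prob (c - real n) A (x + s) - obs_prob (c - real n) A x" and t=x])
    fix y :: real assume y: "0 \<le> y"
    have "\<bar>obs_prob c A (y + s) - obs_prob c A y\<bar> \<le> rate c * s" using c A y s by (rule obs_prob_lipschitz)
    also have "\<dots> \<le> rate c * s + 0 * (x - y) + 1 * exp (- (q powr (- c) / 2) * y)" by simp
    finally show "\<bar>obs_prob (c - real 0) A (y + s) - obs_prob (c - real 0) A y\<bar> \<le>
      rate c * s + 0 * (x - y) + 1 * exp (- (q powr (- c) / 2) * y)" by simp
  next
    fix m y and g :: "real \<Rightarrow> real"
    define a where "a = c - real (Suc m)"
    assume y: "0 \<le> y" and g: "integrable (exp_law (rate (c - real (Suc m)))) g"
      and le: "\<And>h. 0 \<le> h \<Longrightarrow> (if y < h then 1 else down (c - real (Suc m)) +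
        \<bar>obs_prob (c - real m) A (y - h + s) - obs_prob (c - real m) A (y - h)\<bar>) \<le> g h"
    have a: "a \<in> half_ints" unfolding a_def using c by (rule half_ints_minus_nat)
    have a1: "a + 1 = c - real m" by (simp add: a_def)
    note cd = count_down_subset[OF A]
    note b1 = given_hold_bounds[OF half_ints_plus_one[OF a]] and b2 = given_hold_bounds[OF half_ints_minus_one[OF a]]
    let ?F = "\<lambda>h. given_hold A a (obs_prob (a + 1) A) (y + s) h - given_hold A a (obs_prob (a + 1) A) y h"
    let ?G = "\<lambda>h. given_hold A a (obs_prob (a - 1) (count_down A)) (y + s) h - given_hold A a (obs_prob (a - 1) (count_down A)) y h"
    have F1: "\<bar>?F h\<bar> \<le> 1" for h using b1[of A a A "y + s" h] b1[of A a A y h] by linarith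
    have G1: "\<bar>?G h\<bar> \<le> 1" for h
      using b2[of A a "count_down A" "y + s" h] b2[of A a "count_down A" y h] by linarith
    note int = integrable_given_hold[OF half_ints_plus_one[OF a] A] integrable_given_hold[OF half_ints_minus_one[OF a] cd]
    note FG = Bochner_Integration.integral_diff[OF int(1) int(1)] Bochner_Integration.integral_diff[OF int(2) int(2)]
    have "0 \<le> y + s" using y s by simp
    then have eq: "obs_prob a A (y + s) - obs_prob a A y =
        up a * (\<integral>h. ?F h \<partial>exp_law (rate a)) + down a * (\<integral>h. ?G h \<partial>exp_law (rate a))"
      by (simp only: obs_prob_first_step[OF a A y] obs_prob_first_step[OF a A, of "y + s"] FG)
        (simp only: algebra_simps)
    have "\<bar>up a * (\<integral>h. ?F h \<partial>exp_law (rate a)) + down a * (\<integral>h. ?G h \<partial>exp_law (rate a))\<bar>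
      \<le> (\<integral>h. g h \<partial>exp_law (rate a))"
    proof (rule first_step_difference_le[where d="\<lambda>z. obs_prob (a + 1) A (z + s) - obs_prob (a + 1) A z" and x=y])
      show "?F \<in> borel_measurable borel" "?G \<in> borel_measurable borel"
        using a A cd by (auto intro!: borel_measurable_diff measurable_given_hold)
      show "?F h = obs_prob (a + 1) A (y - h + s) - obs_prob (a + 1) A (y - h)" if "h \<le> y" for h
        using that s by (simp add: given_hold_def algebra_simps)
      show "integrable (exp_law (rate a)) g" using g by (simp only: a_def)
      show "(if y < h then 1 else down a + \<bar>obs_prob (a + 1) A (y - h + s) - obs_prob (a + 1) A (y - h)\<bar>) \<le> g h" if "0 \<le> h" for h
        using le[OF that] unfolding a1 by (simp only: a_def)
    qed (rule F1, rule G1)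
    then show "\<bar>obs_prob (c - real (Suc m)) A (y + s) - obs_prob (c - real (Suc m)) A y\<bar> \<le>
        (\<integral>h. g h \<partial>exp_law (rate (c - real (Suc m))))"
      by (simp only: a_def[symmetric] eq)
  qed (use x s rate_pos[of c] in auto)
  then show ?thesis by simp
qed

text \<open>
  The value \<open>v\<close> at the level \<open>b = c - m\<close> and time \<open>t\<close> is kept fixed, and the chain is started
  ever further below \<open>b\<close>. At \<open>b\<close> itself the distance to \<open>v\<close> is a pure time shift, bounded by
  \<open>obs_prob_time_regularity\<close>.
\<close>

lemma obs_prob_level_comparison:
  assumes c: "c \<in> half_ints" and A: "A \<subseteq> UNIV \<times> half_ints" and t: "0 \<le> t"
  shows "\<bar>obs_prob (c - real m - real n) A t - obs_prob (c - real m) A t\<bar> \<le> q powr (2 * c) +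
    (rate c * q powr (c - real m) + q powr (2 * (c - real m))) + 4 * exp (- (q powr (- c) / 2) * t)"
proof -
  define b where "b = c - real m"
  define v where "v = obs_prob b A t"
  have b: "b \<in> half_ints" unfolding b_def using c by (rule half_ints_minus_nat)
  have v: "0 \<le> v" "v \<le> 1" using obs_prob_bounds[OF b] by (auto simp: v_def)
  have "\<bar>obs_prob (b - real n) A t - v\<bar> \<le> q powr (2 * c) + (rate c * q powr b + q powr (2 * b)) +
      rate c * (t - t) + 2 * 2 * exp (- (q powr (- c) / 2) * t)"
  proof (rule propagate_down_levels[where d="\<lambda>n x. obs_prob (b - real n) A x - v" and t=t])
    fix y :: real assume y: "0 \<le> y" "y \<le> t"
    from obs_prob_time_regularity[OF c A y(1), of "t - y" m] y(2)
    show "\<bar>obs_prob (b - real 0) A y - v\<bar> \<le> q powr (2 * c) + rate c * (t - y) + 2 * exp (- (q powr (- c) / 2) * y)"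
      by (simp add: v_def b_def abs_minus_commute)
  next
    fix m y and g :: "real \<Rightarrow> real"
    define a where "a = b - real (Suc m)"
    assume y: "0 \<le> y" and g: "integrable (exp_law (rate (b - real (Suc m)))) g"
      and le: "\<And>h. 0 \<le> h \<Longrightarrow> (if y < h then 1 else down (b - real (Suc m)) + \<bar>obs_prob (b - real m) A (y - h) - v\<bar>) \<le> g h"
    have a: "a \<in> half_ints" unfolding a_def using b by (rule half_ints_minus_nat)
    have a1: "a + 1 = b - real m" by (simp add: a_def)
    note cd = count_down_subset[OF A]
    note b1 = given_hold_bounds[OF half_ints_plus_one[OF a]] and b2 = given_hold_bounds[OF half_ints_minus_one[OF a]]
    let ?F = "\<lambda>h. given_hold A a (obs_prob (a + 1) A) y h - v"
    let ?G = "\<lambda>h. given_hold A a (obs_prob (a - 1) (count_down A)) y h - v"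
    have F1: "\<bar>?F h\<bar> \<le> 1" for h using b1[of A a A y h] v by linarith
    have G1: "\<bar>?G h\<bar> \<le> 1" for h using b2[of A a "count_down A" y h] v by linarith
    interpret E: prob_space "exp_law (rate a)" using rate_pos by (rule prob_space_exp_law)
    have FG: "(\<integral>h. given_hold A a (obs_prob b B) y h - v \<partial>exp_law (rate a)) = (\<integral>h. given_hold A a (obs_prob b B) y h \<partial>exp_law (rate a)) - v"
      if "b \<in> half_ints" "B \<subseteq> UNIV \<times> half_ints" for b B
      using integrable_given_hold[OF that, of a A y] E.prob_space by simp
    note FG = FG[OF half_ints_plus_one[OF a] A] FG[OF half_ints_minus_one[OF a] cd]
    have "obs_prob a A y - (up a + down a) * v =
        up a * (\<integral>h. ?F h \<partial>exp_law (rate a)) + down a * (\<integral>h. ?G h \<partial>exp_law (rate a))"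
      by (simp only: obs_prob_first_step[OF a A y] FG) (simp only: algebra_simps)
    then have eq: "obs_prob a A y - v =
        up a * (\<integral>h. ?F h \<partial>exp_law (rate a)) + down a * (\<integral>h. ?G h \<partial>exp_law (rate a))"
      by (simp only: up_down mult_1)
    have "\<bar>up a * (\<integral>h. ?F h \<partial>exp_law (rate a)) + down a * (\<integral>h. ?G h \<partial>exp_law (rate a))\<bar>
      \<le> (\<integral>h. g h \<partial>exp_law (rate a))"
    proof (rule first_step_difference_le[where d="\<lambda>z. obs_prob (a + 1) A z - v" and x=y])
      show "?F \<in> borel_measurable borel" "?G \<in> borel_measurable borel"
        using a A cd by (auto intro!: borel_measurable_diff measurable_given_hold)
      show "?F h = obs_prob (a + 1) A (y - h) - v" if "h \<le> y" for h
        using that by (simp add: given_hold_def algebra_simps)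
      show "integrable (exp_law (rate a)) g" using g by (simp only: a_def)
      show "(if y < h then 1 else down a + \<bar>obs_prob (a + 1) A (y - h) - v\<bar>) \<le> g h" if "0 \<le> h" for h
        using le[OF that] unfolding a1 by (simp only: a_def)
    qed (rule F1, rule G1)
    then show "\<bar>obs_prob (b - real (Suc m)) A y - v\<bar> \<le> (\<integral>h. g h \<partial>exp_law (rate (b - real (Suc m))))"
      by (simp only: a_def[symmetric] eq)
  next
    show "q powr (- c) / 2 \<le> q powr (- b) / 2" using q by (simp add: b_def)
  qed (use t rate_pos[of c] in auto)
  then show ?thesis by (simp add: b_def v_def)
qed

lemma powr_minus_nat_tendsto: "(\<lambda>k. q powr (x - real k)) \<longlonglongrightarrow> 0"
proof (rule tendsto_sandwich[of "\<lambda>_. 0"])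
  have "(\<lambda>k. q powr x * (1 / 2) ^ k) \<longlonglongrightarrow> q powr x * 0"
    by (intro tendsto_mult_left LIMSEQ_realpow_zero) auto
  then show "(\<lambda>k. q powr x * (1 / 2) ^ k) \<longlonglongrightarrow> 0" by simp
qed (auto intro!: always_eventually powr_minus_nat_le)

text \<open>
  In \<open>obs_prob_level_comparison\<close> the terms that depend on \<open>c\<close> only are made small by the choice
  of \<open>c\<close>; as the factor \<open>rate c\<close> is large then, \<open>b\<close> has to be chosen afterwards.
\<close>

lemma obs_prob_Cauchy:
  assumes t: "0 < t" and e: "0 < e"
  obtains b where "b \<in> half_ints"
    "\<And>a A. a \<in> half_ints \<Longrightarrow> a \<le> b \<Longrightarrow> A \<subseteq> UNIV \<times> half_ints \<Longrightarrow> \<bar>obs_prob a A t - obs_prob b A t\<bar> \<le> e"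
proof -
  have half: "(1 / 2 :: real) \<in> half_ints" by (auto simp: half_ints_def intro: exI[of _ 0])
  have "(\<lambda>k. (q powr (1 / 2 - real k))\<^sup>2 + 8 / t * q powr (1 / 2 - real k)) \<longlonglongrightarrow> 0\<^sup>2 + 8 / t * 0"
    by (intro tendsto_intros powr_minus_nat_tendsto)
  then have "(\<lambda>k. (q powr (1 / 2 - real k))\<^sup>2 + 8 / t * q powr (1 / 2 - real k)) \<longlonglongrightarrow> 0" by simp
  from order_tendstoD(2)[OF this, of "e / 2"] e
  obtain k where k: "(q powr (1 / 2 - real k))\<^sup>2 + 8 / t * q powr (1 / 2 - real k) < e / 2"
    by (auto simp: eventually_sequentially)
  define c where "c = 1 / 2 - real k"
  have c: "c \<in> half_ints" unfolding c_def by (rule half_ints_minus_nat[OF half])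
  have "(\<lambda>m. rate c * q powr (c - real m) + (q powr (c - real m))\<^sup>2) \<longlonglongrightarrow> rate c * 0 + 0\<^sup>2"
    by (intro tendsto_intros powr_minus_nat_tendsto)
  then have "(\<lambda>m. rate c * q powr (c - real m) + (q powr (c - real m))\<^sup>2) \<longlonglongrightarrow> 0" by simp
  from order_tendstoD(2)[OF this, of "e / 2"] e
  obtain m where m: "rate c * q powr (c - real m) + (q powr (c - real m))\<^sup>2 < e / 2"
    by (auto simp: eventually_sequentially)
  define b where "b = c - real m"
  have b: "b \<in> half_ints" unfolding b_def using c by (rule half_ints_minus_nat)
  have sq: "q powr (2 * x) = (q powr x)\<^sup>2" for x
    using powr_add[of q x x] by (simp add: power2_eq_square)
  have "4 * exp (- (q powr (- c) / 2) * t) \<le> 8 / t * q powr c"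
  proof -
    define z where "z = q powr (- c) / 2 * t"
    have z: "0 < z" unfolding z_def using q t by simp
    have "exp (- z) = 1 / exp z" by (simp add: exp_minus inverse_eq_divide)
    also have "z \<le> exp z" using exp_ge_add_one_self[of z] by linarith
    then have "1 / exp z \<le> 1 / z" using z by (intro divide_left_mono) auto
    also have "1 / z = 2 / t * q powr c" by (simp add: z_def powr_minus field_simps)
    finally show ?thesis by (simp add: z_def)
  qed
  with k have ck: "q powr (2 * c) + 4 * exp (- (q powr (- c) / 2) * t) < e / 2"
    unfolding sq by (simp add: c_def)
  show thesis
  proof (rule that[OF b])
    fix a and A :: "(nat \<times> real) set"
    assume a: "a \<in> half_ints" "a \<le> b" and A: "A \<subseteq> UNIV \<times> half_ints"
    obtain i j :: int where "a = of_int i + 1 / 2" "b = of_int j + 1 / 2"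
      using a b by (auto simp: half_ints_def)
    with a(2) have "a = b - real (nat (j - i))" by simp
    then obtain n where n: "a = b - real n" by blast
    have "\<bar>obs_prob (c - real m - real n) A t - obs_prob (c - real m) A t\<bar> \<le> q powr (2 * c) +
      (rate c * q powr (c - real m) + q powr (2 * (c - real m))) + 4 * exp (- (q powr (- c) / 2) * t)"
      using t by (intro obs_prob_level_comparison[OF c A]) simp
    also have "\<dots> \<le> e" using ck m unfolding sq by linarith
    finally show "\<bar>obs_prob a A t - obs_prob b A t\<bar> \<le> e" by (simp add: n b_def)
  qed
qed

end

section \<open>Completeness of total variation\<close>

text \<open>
  The limit set function is finitely additive. It is countably additive because the
  convergence is uniform over the \<open>\<sigma>\<close>-algebra, so the limit along the sequence of measures and the
  limit along an increasing sequence of events may be interchanged.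
\<close>

lemma uniformly_Cauchy_prob_converges:
  fixes P :: "nat \<Rightarrow> 'b measure"
  assumes prob: "\<And>k. prob_space (P k)" and sets: "\<And>k. sets (P k) = sets \<Sigma>"
    and Cauchy: "uniformly_Cauchy_on (sets \<Sigma>) (\<lambda>k. measure (P k))"
  obtains \<mu> where "prob_space \<mu>" "sets \<mu> = sets \<Sigma>"
    "\<And>A. A \<in> sets \<Sigma> \<Longrightarrow> (\<lambda>k. measure (P k) A) \<longlonglongrightarrow> measure \<mu> A"
proof -
  from Cauchy_uniformly_convergent[OF Cauchy] obtain m
    where unif: "uniform_limit (sets \<Sigma>) (\<lambda>k. measure (P k)) m sequentially"
    by (auto simp: uniformly_convergent_on_def)
  have lim: "(\<lambda>k. measure (P k) A) \<longlonglongrightarrow> m A" if "A \<in> sets \<Sigma>" for A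
    using unif that by (rule tendsto_uniform_limitI)
  have space: "space (P k) = space \<Sigma>" for k using sets by (rule sets_eq_imp_space_eq)
  have nonneg: "0 \<le> m A" if "A \<in> sets \<Sigma>" for A
    using lim[OF that] by (rule LIMSEQ_le_const) auto
  have add: "m (\<Union>i<n. A i) = (\<Sum>i<n. m (A i))"
    if A: "range A \<subseteq> sets \<Sigma>" "disjoint_family A" for A :: "nat \<Rightarrow> 'b set" and n :: nat
  proof (rule LIMSEQ_unique)
    have un: "(\<Union>i<n. A i) \<in> sets \<Sigma>" using A by auto
    then show "(\<lambda>k. measure (P k) (\<Union>i<n. A i)) \<longlonglongrightarrow> m (\<Union>i<n. A i)" by (rule lim)
    have "measure (P k) (\<Union>i<n. A i) = (\<Sum>i<n. measure (P k) (A i))" for k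
    proof -
      interpret prob_space "P k" by (rule prob)
      show ?thesis
        using A by (intro finite_measure_finite_Union) (auto simp: sets disjoint_family_on_def)
    qed
    moreover have "(\<lambda>k. \<Sum>i<n. measure (P k) (A i)) \<longlonglongrightarrow> (\<Sum>i<n. m (A i))"
      using A by (intro tendsto_sum lim) auto
    ultimately show "(\<lambda>k. measure (P k) (\<Union>i<n. A i)) \<longlonglongrightarrow> (\<Sum>i<n. m (A i))" by simp
  qed
  have "countably_additive (sets \<Sigma>) (\<lambda>A. ennreal (m A))"
  proof (rule countably_additiveI)
    fix A :: "nat \<Rightarrow> 'b set"
    assume A: "range A \<subseteq> sets \<Sigma>" "disjoint_family A" "(\<Union>i. A i) \<in> sets \<Sigma>"
    have "(\<lambda>n. m (\<Union>i<n. A i)) \<longlonglongrightarrow> m (\<Union>i. A i)"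
    proof (rule swap_uniform_limit'[where F=sequentially and S=UNIV])
      show "\<forall>\<^sub>F k in sequentially. (\<lambda>n. measure (P k) (\<Union>i<n. A i)) \<longlonglongrightarrow> measure (P k) (\<Union>i. A i)"
      proof (rule always_eventually, rule allI)
        fix k
        interpret prob_space "P k" by (rule prob)
        have "(\<lambda>n. measure (P k) (\<Union>i<n. A i)) \<longlonglongrightarrow> measure (P k) (\<Union>n. \<Union>i<n. A i)"
        proof (rule finite_Lim_measure_incseq)
          show "range (\<lambda>n. \<Union>i<n. A i) \<subseteq> sets (P k)" using A by (auto simp: sets)
          show "incseq (\<lambda>n. \<Union>i<n. A i)" by (rule incseq_SucI) (auto simp: less_Suc_eq)
        qed
        also have "(\<Union>n. \<Union>i<n. A i) = (\<Union>i. A i)" by auto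
        finally show "(\<lambda>n. measure (P k) (\<Union>i<n. A i)) \<longlonglongrightarrow> measure (P k) (\<Union>i. A i)" .
      qed
      show "(\<lambda>k. measure (P k) (\<Union>i. A i)) \<longlonglongrightarrow> m (\<Union>i. A i)" using A(3) by (rule lim)
      show "uniform_limit UNIV (\<lambda>k n. measure (P k) (\<Union>i<n. A i)) (\<lambda>n. m (\<Union>i<n. A i)) sequentially"
        unfolding uniform_limit_iff
      proof (intro allI impI)
        fix e :: real assume "0 < e"
        have "(\<Union>i<n. A i) \<in> sets \<Sigma>" for n :: nat using A by auto
        then show "\<forall>\<^sub>F k in sequentially. \<forall>n\<in>UNIV. dist (measure (P k) (\<Union>i<n. A i)) (m (\<Union>i<n. A i)) < e"
          using uniform_limitD[OF unif \<open>0 < e\<close>] by (auto elim: eventually_mono)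
      qed
    qed simp_all
    then have "(\<lambda>i. m (A i)) sums m (\<Union>i. A i)"
      unfolding sums_def using add[OF A(1,2)] by simp
    then show "(\<Sum>i. ennreal (m (A i))) = ennreal (m (\<Union>i. A i))"
      using A by (intro suminf_ennreal_eq nonneg) auto
  qed
  moreover have "positive (sets \<Sigma>) (\<lambda>A. ennreal (m A))"
    using LIMSEQ_unique[OF lim[of "{}"], of 0] by (simp add: positive_def)
  ultimately have em: "emeasure (measure_of (space \<Sigma>) (sets \<Sigma>) (\<lambda>A. ennreal (m A))) A = ennreal (m A)"
    if "A \<in> sets \<Sigma>" for A
    using that by (intro emeasure_measure_of_sigma sets.sigma_algebra_axioms)
  define \<mu> where "\<mu> = measure_of (space \<Sigma>) (sets \<Sigma>) (\<lambda>A. ennreal (m A))"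
  have s: "sets \<mu> = sets \<Sigma>" "space \<mu> = space \<Sigma>" by (simp_all add: \<mu>_def)
  have "measure (P k) (space \<Sigma>) = 1" for k
    using prob_space.prob_space[OF prob[of k]] by (simp add: space)
  then have "m (space \<Sigma>) = 1" using LIMSEQ_unique[OF lim[of "space \<Sigma>"], of 1] by simp
  then have "prob_space \<mu>" by (intro prob_spaceI) (simp add: s(2), simp add: \<mu>_def em)
  moreover have "measure \<mu> A = m A" if "A \<in> sets \<Sigma>" for A
    using em[OF that] nonneg[OF that] by (simp add: measure_def \<mu>_def)
  ultimately show thesis using that s(1) lim by simp
qed

lemma tv_dist_le:
  assumes "prob_space M" "prob_space N" "sets M = sets N"
    and "\<And>A. A \<in> sets M \<Longrightarrow> \<bar>measure M A - measure N A\<bar> \<le> e"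
  shows "0 \<le> tv_dist M N" "tv_dist M N \<le> e"
proof -
  show "tv_dist M N \<le> e" unfolding tv_dist_def using assms(4) by (intro cSUP_least) auto
  have "bdd_above ((\<lambda>A. \<bar>measure M A - measure N A\<bar>) ` sets M)"
    using assms(4) by (intro bdd_aboveI[of _ e]) auto
  then have "\<bar>measure M {} - measure N {}\<bar> \<le> tv_dist M N"
    unfolding tv_dist_def by (intro cSUP_upper) auto
  then show "0 \<le> tv_dist M N" by simp
qed

section \<open>From paths to trajectories\<close>

text \<open>
  The path is constant between jump times, so it has a left limit \<open>y m\<close> everywhere after the
  \<open>m\<close>-th jump time up to and including the next one. Only at jump times can the value differ from the
  left limit, and there it does so by the step of the jump chain.
\<close>

lemma step_path_observation:
  fixes x :: "real \<Rightarrow> real" and y h :: "nat \<Rightarrow> real"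
  defines "J \<equiv> \<lambda>n. \<Sum>i<n. h i"
  assumes h: "\<And>n. 0 < h n" and lim: "filterlim J at_top sequentially"
    and x: "\<And>n s. J n \<le> s \<Longrightarrow> s < J (Suc n) \<Longrightarrow> x s = y n"
    and t: "0 \<le> t"
  obtains n where "J n \<le> t" "t < J (Suc n)" "\<And>m. J m \<le> t \<Longrightarrow> t < J (Suc m) \<Longrightarrow> m = n"
    "x t = y n"
    "card {s. 0 < s \<and> s \<le> t \<and> (\<exists>b. (\<forall>\<^sub>F u in at_left s. x u = b) \<and> x s = b - 1)} =
      card {i. i < n \<and> y (Suc i) = y i - 1}"
proof -
  have J0: "J 0 = 0" by (simp add: J_def)
  have mono: "strict_mono J" using h by (intro strict_mono_Suc_iff[THEN iffD2]) (simp add: J_def)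
  have ex: "\<exists>n. J n \<le> s \<and> s < J (Suc n)" if s: "0 \<le> s" for s
  proof -
    from filterlim_at_top_dense[THEN iffD1, OF lim, rule_format, of s] obtain k where "s < J k"
      by (auto simp: eventually_sequentially)
    then have "s < J (LEAST k. s < J k)" by (rule LeastI)
    moreover from this s J0 obtain n where n: "(LEAST k. s < J k) = Suc n" by (cases "LEAST k. s < J k") auto
    moreover have "\<not> s < J n" using not_less_Least[of n "\<lambda>k. s < J k"] n by simp
    ultimately show ?thesis by (intro exI[of _ n]) simp
  qed
  have before: "m \<le> n" if "J m \<le> s" "s < J (Suc n)" for m n s
    using that strict_mono_less[OF mono, of m "Suc n"] by simp
  obtain n where n: "J n \<le> t" "t < J (Suc n)" using ex[OF t] by blast
  have left: "(\<forall>\<^sub>F u in at_left s. x u = b) \<longleftrightarrow> b = y m" if "J m < s" "s \<le> J (Suc m)" for s b m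
  proof -
    have ev: "\<forall>\<^sub>F u in at_left s. x u = y m"
      using eventually_at_left_real[OF that(1)] by eventually_elim (use that x in auto)
    show ?thesis
    proof
      assume "\<forall>\<^sub>F u in at_left s. x u = b"
      with ev have "\<forall>\<^sub>F u in at_left s. b = y m" by eventually_elim simp
      then show "b = y m" by (simp add: eventually_const_iff)
    qed (use ev in simp)
  qed
  let ?L = "{s. 0 < s \<and> s \<le> t \<and> (\<exists>b. (\<forall>\<^sub>F u in at_left s. x u = b) \<and> x s = b - 1)}"
  let ?R = "{i. i < n \<and> y (Suc i) = y i - 1}"
  have jump: "x (J (Suc i)) = y (Suc i)" "(\<forall>\<^sub>F u in at_left (J (Suc i)). x u = b) \<longleftrightarrow> b = y i" for i b
    using strict_monoD[OF mono, of "Suc i" "Suc (Suc i)"] strict_monoD[OF mono, of i "Suc i"]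
    by (auto intro!: x left)
  have "?L = (\<lambda>i. J (Suc i)) ` ?R"
  proof (intro equalityI subsetI)
    fix s assume s: "s \<in> ?L"
    then obtain m where m: "J m \<le> s" "s < J (Suc m)" using ex[of s] by auto
    from s obtain b where b: "\<forall>\<^sub>F u in at_left s. x u = b" "x s = b - 1" by auto
    have "\<not> J m < s"
    proof
      assume "J m < s"
      then have "b = y m" using left[of m s b] m b by simp
      then show False using b(2) x[OF m] by simp
    qed
    then have sm: "s = J m" using m by simp
    then obtain i where i: "m = Suc i" using s J0 by (cases m) auto
    have "y (Suc i) = y i - 1" using b jump(1)[of i] jump(2)[where i=i and b=b] unfolding sm i by simp
    moreover have "m \<le> n" using s n m by (intro before[of m s n]) auto
    ultimately show "s \<in> (\<lambda>i. J (Suc i)) ` ?R" using sm i by auto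
  next
    fix s assume "s \<in> (\<lambda>i. J (Suc i)) ` ?R"
    then obtain i where i: "i < n" "y (Suc i) = y i - 1" "s = J (Suc i)" by auto
    have "J 0 < J (Suc i)" "J (Suc i) \<le> J n"
      using i strict_mono_less[OF mono] strict_mono_less_eq[OF mono] by auto
    then show "s \<in> ?L" using i n jump J0 by auto
  qed
  moreover have "inj_on (\<lambda>i. J (Suc i)) ?R"
    using strict_mono_eq[OF mono] by (auto simp: inj_on_def)
  ultimately have "card ?L = card ?R" by (simp add: card_image)
  moreover have "m = n" if "J m \<le> t" "t < J (Suc m)" for m
    using before[OF that(1) n(2)] before[OF n(1) that(2)] by simp
  ultimately show thesis using that n x[OF n] by blast
qed

lemma ctmc_observation:
  assumes "ctmc M half_ints Q a X" and t: "0 \<le> t"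
  obtains f where "f \<in> measurable M (traj_space half_ints)"
    "traj_law half_ints Q a (distr M (traj_space half_ints) f)"
    "\<And>\<omega> A. \<omega> \<in> space M \<Longrightarrow> (down_jumps X t \<omega>, X t \<omega>) \<in> A \<longleftrightarrow> f \<omega> \<in> obs_event A t"
proof -
  from assms(1) obtain Y H where M: "prob_space M"
    and Y: "\<And>n. Y n \<in> measurable M (count_space half_ints)" and H: "\<And>n. H n \<in> borel_measurable M"
    and law: "jump_hold_law M half_ints Q a Y H"
    and pos: "\<And>n \<omega>. \<omega> \<in> space M \<Longrightarrow> 0 < H n \<omega>"
    and lim: "\<And>\<omega>. \<omega> \<in> space M \<Longrightarrow> filterlim (\<lambda>n. jump_time H n \<omega>) at_top sequentially"
    and X: "\<And>\<omega> n s. \<omega> \<in> space M \<Longrightarrow> jump_time H n \<omega> \<le> s \<Longrightarrow> s < jump_time H (Suc n) \<omega> \<Longrightarrow> X s \<omega> = Y n \<omega>"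
    unfolding ctmc_def by blast
  let ?f = "\<lambda>\<omega> n. (Y n \<omega>, H n \<omega>)"
  note f = traj_law_distr[OF M Y H pos law]
  show thesis
  proof (rule that[OF f])
    fix \<omega> and A :: "(nat \<times> real) set" assume \<omega>: "\<omega> \<in> space M"
    have "?f \<omega> \<in> traj half_ints" using measurable_space[OF f(1) \<omega>] by simp
    moreover obtain n where n: "(\<Sum>i<n. H i \<omega>) \<le> t" "t < (\<Sum>i<Suc n. H i \<omega>)"
      "\<And>m. (\<Sum>i<m. H i \<omega>) \<le> t \<Longrightarrow> t < (\<Sum>i<Suc m. H i \<omega>) \<Longrightarrow> m = n"
      and x: "X t \<omega> = Y n \<omega>"
      and card: "card {s. 0 < s \<and> s \<le> t \<and> (\<exists>b. (\<forall>\<^sub>F u in at_left s. X u \<omega> = b) \<and> X s \<omega> = b - 1)} =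
        card {i. i < n \<and> Y (Suc i) \<omega> = Y i \<omega> - 1}"
      by (rule step_path_observation[where h="\<lambda>n. H n \<omega>" and x="\<lambda>s. X s \<omega>" and y="\<lambda>n. Y n \<omega>" and t=t,
        OF pos[OF \<omega>] lim[OF \<omega>, unfolded jump_time_def] X[OF \<omega>, unfolded jump_time_def] t]) blast+
    have "(down_jumps X t \<omega>, X t \<omega>) = (down_steps (?f \<omega>) n, fst (?f \<omega> n))"
      using card x by (simp add: down_jumps_def down_steps_def)
    moreover have "(\<exists>m. (\<Sum>i<m. H i \<omega>) \<le> t \<and> t < (\<Sum>i<Suc m. H i \<omega>) \<and> p m \<in> A) \<longleftrightarrow> p n \<in> A"
      for p :: "nat \<Rightarrow> nat \<times> real"
      using n by blast
    ultimately show "(down_jumps X t \<omega>, X t \<omega>) \<in> A \<longleftrightarrow> ?f \<omega> \<in> obs_event A t"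
      unfolding obs_event_def by simp
  qed
qed

text \<open>
  The Cauchy estimate is applied along the starting points \<open>1/2 - k\<close> to construct the limit, and
  then again to compare it with arbitrary starting points.
\<close>

theorem lemma13:
  fixes q :: nat
    and M :: "real \<Rightarrow> 'w measure"
    and Z :: "real \<Rightarrow> real \<Rightarrow> 'w \<Rightarrow> real"
    and t :: real
  assumes "primepow q"
    and "\<And>a. a \<in> half_ints \<Longrightarrow> ctmc (M a) half_ints (Q_odd (real q)) a (Z a)"
    and "t > 0"
  shows "\<exists>\<mu> :: (nat \<times> real) measure.
    prob_space \<mu> \<and> sets \<mu> = sets (count_space (UNIV \<times> half_ints)) \<and>
    (\<forall>a\<in>half_ints. (\<lambda>\<omega>. (down_jumps (Z a) t \<omega>, Z a t \<omega>))
        \<in> measurable (M a) (count_space (UNIV \<times> half_ints))) \<and>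
    ((\<lambda>a. tv_dist
        (distr (M a) (count_space (UNIV \<times> half_ints)) (\<lambda>\<omega>. (down_jumps (Z a) t \<omega>, Z a t \<omega>))) \<mu>)
      \<longlongrightarrow> 0) (inf at_bot (principal half_ints))"
proof -
  let ?\<Sigma> = "count_space (UNIV \<times> half_ints) :: (nat \<times> real) measure"
  let ?g = "\<lambda>a \<omega>. (down_jumps (Z a) t \<omega>, Z a t \<omega>)"
  have "\<forall>a\<in>half_ints. \<exists>f. f \<in> measurable (M a) (traj_space half_ints) \<and>
    traj_law half_ints (Q_odd (real q)) a (distr (M a) (traj_space half_ints) f) \<and>
    (\<forall>\<omega>\<in>space (M a). \<forall>A. ?g a \<omega> \<in> A \<longleftrightarrow> f \<omega> \<in> obs_event A t)"
  proof
    fix a :: real assume "a \<in> half_ints"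
    from ctmc_observation[OF assms(2)[OF this], of t] assms(3)
    show "\<exists>f. f \<in> measurable (M a) (traj_space half_ints) \<and>
      traj_law half_ints (Q_odd (real q)) a (distr (M a) (traj_space half_ints) f) \<and>
      (\<forall>\<omega>\<in>space (M a). \<forall>A. ?g a \<omega> \<in> A \<longleftrightarrow> f \<omega> \<in> obs_event A t)"
      by (metis less_imp_le)
  qed
  from bchoice[OF this] obtain f where
    f: "\<And>a. a \<in> half_ints \<Longrightarrow> f a \<in> measurable (M a) (traj_space half_ints)"
    and law: "\<And>a. a \<in> half_ints \<Longrightarrow>
      traj_law half_ints (Q_odd (real q)) a (distr (M a) (traj_space half_ints) (f a))"
    and obs: "\<And>a \<omega> A. a \<in> half_ints \<Longrightarrow> \<omega> \<in> space (M a) \<Longrightarrow> ?g a \<omega> \<in> A \<longleftrightarrow> f a \<omega> \<in> obs_event A t"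
    by blast
  have "2 \<le> real q" using primepow_gt_Suc_0[OF assms(1)] by simp
  then interpret odd_chain "real q" "\<lambda>a. distr (M a) (traj_space half_ints) (f a)"
    using law by unfold_locales
  have pre: "?g a -` A \<inter> space (M a) = f a -` obs_event A t \<inter> space (M a)" if "a \<in> half_ints" for a A
    using obs[OF that] by auto
  have g: "?g a \<in> measurable (M a) ?\<Sigma>" if a: "a \<in> half_ints" for a
  proof (rule measurableI)
    fix \<omega> assume "\<omega> \<in> space (M a)"
    note obs = obs[OF a this]
    have "f a \<omega> \<in> obs_event UNIV t" using obs[of UNIV] by simp
    then have "f a \<omega> \<in> obs_event (UNIV \<times> half_ints) t" by (auto simp: obs_event_def traj_def)
    then show "?g a \<omega> \<in> space ?\<Sigma>" unfolding obs[symmetric] by simp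
  next
    fix A assume "A \<in> sets ?\<Sigma>"
    then show "?g a -` A \<inter> space (M a) \<in> sets (M a)"
      unfolding pre[OF a] by (intro measurable_sets[OF f[OF a]] obs_event_sets) simp
  qed
  define P where "P a = distr (M a) ?\<Sigma> (?g a)" for a
  have prob_P: "prob_space (P a)" if "a \<in> half_ints" for a
    using assms(2)[OF that] g[OF that] unfolding P_def ctmc_def by (intro prob_space.prob_space_distr) auto
  have sets_P: "sets (P a) = sets ?\<Sigma>" for a by (simp add: P_def)
  have P: "measure (P a) A = obs_prob a A t" if a: "a \<in> half_ints" and A: "A \<in> sets ?\<Sigma>" for a A
    unfolding P_def obs_prob_def using A
    by (simp only: measure_distr[OF g[OF a] A] measure_distr[OF f[OF a] obs_event_sets] sets_count_space Pow_iff pre[OF a])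
  have half: "1 / 2 - real k \<in> half_ints" for k
    by (intro half_ints_minus_nat) (auto simp: half_ints_def intro: exI[of _ 0])
  have close: "\<exists>b\<in>half_ints. \<forall>a\<in>half_ints. a \<le> b \<longrightarrow> (\<forall>A\<in>sets ?\<Sigma>. \<bar>measure (P a) A - measure (P b) A\<bar> \<le> e)"
    if e: "0 < e" for e
  proof -
    obtain b where b: "b \<in> half_ints"
      "\<And>a A. a \<in> half_ints \<Longrightarrow> a \<le> b \<Longrightarrow> A \<subseteq> UNIV \<times> half_ints \<Longrightarrow> \<bar>obs_prob a A t - obs_prob b A t\<bar> \<le> e"
      using obs_prob_Cauchy[OF assms(3) e] by blast
    have "\<bar>measure (P a) A - measure (P b) A\<bar> \<le> e" if "a \<in> half_ints" "a \<le> b" "A \<in> sets ?\<Sigma>" for a A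
      using b(2)[of a A] that unfolding P[OF that(1,3)] P[OF b(1) that(3)] by simp
    with b(1) show ?thesis by blast
  qed
  have low: "\<exists>K. \<forall>k\<ge>K. 1 / 2 - real k \<le> b" for b
    by (rule exI[of _ "nat \<lceil>1 / 2 - b\<rceil>"]) (auto simp: nat_le_iff ceiling_le_iff algebra_simps)
  have "uniformly_Cauchy_on (sets ?\<Sigma>) (\<lambda>k. measure (P (1 / 2 - real k)))"
  proof (rule uniformly_Cauchy_onI)
    fix e :: real assume e: "0 < e"
    then obtain b where b: "\<And>a A. a \<in> half_ints \<Longrightarrow> a \<le> b \<Longrightarrow> A \<in> sets ?\<Sigma> \<Longrightarrow> \<bar>measure (P a) A - measure (P b) A\<bar> \<le> e / 3"
      using close[of "e / 3"] by auto
    from low obtain K where K: "\<And>k. K \<le> k \<Longrightarrow> 1 / 2 - real k \<le> b" by blast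
    show "\<exists>K. \<forall>A\<in>sets ?\<Sigma>. \<forall>m\<ge>K. \<forall>n\<ge>K. dist (measure (P (1 / 2 - real m)) A) (measure (P (1 / 2 - real n)) A) < e"
    proof (intro exI[of _ K] ballI allI impI)
      fix A m n assume A: "A \<in> sets ?\<Sigma>" and mn: "K \<le> m" "K \<le> n"
      show "dist (measure (P (1 / 2 - real m)) A) (measure (P (1 / 2 - real n)) A) < e"
        using b[OF half K[OF mn(1)] A] b[OF half K[OF mn(2)] A] e unfolding dist_real_def by linarith
    qed
  qed
  from uniformly_Cauchy_prob_converges[OF prob_P[OF half] sets_P this] obtain \<mu>
    where \<mu>: "prob_space \<mu>" "sets \<mu> = sets ?\<Sigma>"
      and lim: "\<And>A. A \<in> sets ?\<Sigma> \<Longrightarrow> (\<lambda>k. measure (P (1 / 2 - real k)) A) \<longlonglongrightarrow> measure \<mu> A"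
    by blast
  have "((\<lambda>a. tv_dist (P a) \<mu>) \<longlongrightarrow> 0) (inf at_bot (principal half_ints))"
  proof (rule tendstoI)
    fix e :: real assume e: "0 < e"
    then obtain b where b: "b \<in> half_ints"
      "\<And>a A. a \<in> half_ints \<Longrightarrow> a \<le> b \<Longrightarrow> A \<in> sets ?\<Sigma> \<Longrightarrow> \<bar>measure (P a) A - measure (P b) A\<bar> \<le> e / 3"
      using close[of "e / 3"] by auto
    have "dist (tv_dist (P a) \<mu>) 0 < e" if a: "a \<in> half_ints" "a \<le> b" for a
    proof -
      have bound: "\<bar>measure (P a) A - measure \<mu> A\<bar> \<le> 2 * e / 3" if "A \<in> sets (P a)" for A
      proof -
        have A: "A \<in> sets ?\<Sigma>" using that by (simp only: sets_P)
        from low obtain K where K: "\<And>k. K \<le> k \<Longrightarrow> 1 / 2 - real k \<le> b" by blast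
        have "\<bar>measure (P b) A - measure \<mu> A\<bar> \<le> e / 3"
        proof (rule LIMSEQ_le_const2)
          show "(\<lambda>k. \<bar>measure (P b) A - measure (P (1 / 2 - real k)) A\<bar>) \<longlonglongrightarrow> \<bar>measure (P b) A - measure \<mu> A\<bar>"
            by (intro tendsto_intros lim A)
          show "\<exists>K. \<forall>k\<ge>K. \<bar>measure (P b) A - measure (P (1 / 2 - real k)) A\<bar> \<le> e / 3"
            using b(2)[OF half K A] by (auto simp: abs_minus_commute)
        qed
        then show ?thesis using b(2)[OF a A] by linarith
      qed
      have "sets (P a) = sets \<mu>" by (simp only: sets_P \<mu>(2))
      from tv_dist_le[OF prob_P[OF a(1)] \<mu>(1) this bound] e show ?thesis by simp
    qed
    then show "\<forall>\<^sub>F a in inf at_bot (principal half_ints). dist (tv_dist (P a) \<mu>) 0 < e"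
      unfolding eventually_inf_principal eventually_at_bot_linorder by blast
  qed
  then show ?thesis using \<mu> g unfolding P_def by blast
qed

end
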